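(* Let $q\in\mathbb{C}$ with $0<|q|<1$. Let $f$ be holomorphic in $|z|<R$, where $R>1$, let $c,t\in\mathbb{C}$, and suppose that $|t|<R$. Then the identity \[ \sum_{n=0}^{\infty}\frac{(c;q)_n}{(q;q)_n}t^n\Delta_n^{(c)}(f)=\frac{(c;q)_\infty}{(q,t,q/t;q)_\infty}\int_t^1\frac{(sq/t,sq,cts;q)_\infty}{(cs^2;q)_\infty}f(s)\,d_qs \] holds wherever the displayed expressions are defined, where \[ \Delta_n^{(c)}(f)=\sum_{k=0}^n\frac{(q^{-n},cq^n;q)_k}{(q;q)_k}f(q^k)q^k . \]
   Context: For $a\in\mathbb{C}$ and $n\in\{0,1,2,\ldots\}\cup\{\infty\}$, $(a;q)_n=\prod_{j=0}^{n-1}(1-aq^j)$ and $(a_1,\ldots,a_r;q)_n=\prod_{i=1}^r(a_i;q)_n$. The Jackson $q$-integral (without the conventional factor $1-q$) is \[ \int_u^v g(s)\,d_qs:=\sum_{n=0}^{\infty}\bigl(vq^n g(vq^n)-uq^n g(uq^n)\bigr), \] whenever the series converges. Double sums are understood as iterated sums, with the terminating inner sum evaluated first. Parameters are assumed to be such that no denominator vanishes. *)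

theory Defs
  imports "HOL-Complex_Analysis.Complex_Analysis"
begin

definition qpoch :: "complex \<Rightarrow> complex \<Rightarrow> nat \<Rightarrow> complex" where
  "qpoch a q n = (\<Prod>j<n. 1 - a * q ^ j)"

definition qpoch_inf :: "complex \<Rightarrow> complex \<Rightarrow> complex" where
  "qpoch_inf a q = (\<Prod>j. 1 - a * q ^ j)"

definition qpochs :: "complex list \<Rightarrow> complex \<Rightarrow> nat \<Rightarrow> complex" where
  "qpochs as q n = (\<Prod>a\<leftarrow>as. qpoch a q n)"

definition qpochs_inf :: "complex list \<Rightarrow> complex \<Rightarrow> complex" where
  "qpochs_inf as q = (\<Prod>a\<leftarrow>as. qpoch_inf a q)"

(* Jackson q-integral, normalised without the conventional factor 1 - q. The two
   end points are combined termwise, so only the series of differences has to converge. *)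

definition q_integral_term ::
  "complex \<Rightarrow> complex \<Rightarrow> complex \<Rightarrow> (complex \<Rightarrow> complex) \<Rightarrow> nat \<Rightarrow> complex" where
  "q_integral_term q u v g n = v * q ^ n * g (v * q ^ n) - u * q ^ n * g (u * q ^ n)"

definition q_integrable ::
  "complex \<Rightarrow> complex \<Rightarrow> complex \<Rightarrow> (complex \<Rightarrow> complex) \<Rightarrow> bool" where
  "q_integrable q u v g \<longleftrightarrow> summable (q_integral_term q u v g)"

definition q_integral ::
  "complex \<Rightarrow> complex \<Rightarrow> complex \<Rightarrow> (complex \<Rightarrow> complex) \<Rightarrow> complex" where
  "q_integral q u v g = (\<Sum>n. q_integral_term q u v g n)"

definition q_Delta ::
  "complex \<Rightarrow> complex \<Rightarrow> (complex \<Rightarrow> complex) \<Rightarrow> nat \<Rightarrow> complex" where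
  "q_Delta q c f n =
     (\<Sum>k\<le>n. qpochs [inverse q ^ n, c * q ^ n] q k / qpoch q q k * f (q ^ k) * q ^ k)"

end

theory Submission
  imports Defs
begin

text \<open>
  Both sides of the identity are linear in \<open>f\<close>, and they obey the same reduction rule. If
  \<open>f s = (1 - s) * h s\<close>, then on either side passing from \<open>f\<close> to \<open>\<lambda>s. h (q * s)\<close> replaces the
  parameters \<open>(c, t)\<close> by \<open>(c * q\<^sup>2, t / q)\<close> and produces the same factor
  \<open>- t * (1 - c) * (1 - c * q)\<close>: on the left because the factor \<open>1 - q ^ k\<close> cancels the last factor
  of \<open>(q;q)\<^sub>k\<close>, on the right because \<open>(1 - s) (sq)\<^sub>\<infinity> = (s)\<^sub>\<infinity>\<close> vanishes at the top node \<open>s = 1\<close> and the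
  substitution \<open>s \<mapsto> q * s\<close> restores the shape of the weight (\<open>delta_term_one_minus\<close>,
  \<open>jackson_one_minus\<close>). Induction on the degree thus proves the identity for every polynomial as
  soon as it is known for \<open>f = 1\<close> and all parameters (\<open>transform_identity_poly\<close>).

  For \<open>f = 1\<close> the q-Vandermonde sum gives \<open>\<Delta>\<^sub>n = (c q\<^sup>n)\<^sup>n\<close>, and two steps remain.
  If \<open>c = 0\<close>, the left side is \<open>1\<close> and the claim is that the Jackson integral of the weight is the
  theta product \<open>\<theta>(t) = (q, t, q/t)\<^sub>\<infinity>\<close>. Both satisfy \<open>F (t * q) = - F t / t\<close>, by a telescoping
  sum for the integral, and their ratio tends to \<open>1\<close> along \<open>t * q ^ N\<close>
  (\<open>jackson_zero_one\<close>). The polynomial case for \<open>c = 0\<close> then yields all moments of this weight.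
  If \<open>c\<close> is small, the quotient \<open>(cts)\<^sub>\<infinity> / (cs\<^sup>2)\<^sub>\<infinity>\<close> is expanded by the q-binomial theorem into
  the functions \<open>s\<^sup>N \<Prod>\<^sub>j\<^sub><\<^sub>N (s - t q\<^sup>j)\<close>. Each product moves the lower end point from \<open>t\<close> to
  \<open>t q\<^sup>N\<close>, so that only moments have to be evaluated, and the resulting double sum rearranges to
  the left side. Both sides, multiplied by \<open>(c t\<^sup>2)\<^sub>\<infinity>\<close>, are holomorphic in \<open>c\<close>, which removes
  the restriction on \<open>c\<close> (\<open>transform_identity_one\<close>).

  Finally \<open>f\<close> is expanded in its Taylor series. The point is the estimate
  \<open>\<bar>\<Delta>\<^sub>n(s\<^sup>m)\<bar> \<le> K r\<^sup>m / r\<^sup>n\<close> for every \<open>r > 1\<close> (\<open>norm_q_Delta_power_le\<close>): it makes the left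
  side absolutely convergent as a double series when \<open>\<bar>t\<bar> < r < R\<close>, although the terms
  of the finite sum \<open>\<Delta>\<^sub>n(1)\<close> grow like \<open>\<bar>q\<bar>\<close> to the power \<open>- n (n - 1) / 2\<close>.
\<close>

section \<open>q-shifted factorials and the q-binomial theorem\<close>

text \<open>
  Every exchange of summations below has a majorant of product form, so this is the only version of
  Fubini's theorem that occurs.
\<close>

lemma dominated_double_series:
  fixes x :: "nat \<Rightarrow> nat \<Rightarrow> complex" and \<alpha> \<beta> :: "nat \<Rightarrow> real"
  assumes bound: "\<And>n m. norm (x n m) \<le> \<alpha> n * \<beta> m"
    and \<alpha>: "summable \<alpha>" and \<beta>: "summable \<beta>"
  shows "summable (\<lambda>m. x n m)" and "summable (\<lambda>n. x n m)"
    and "summable (\<lambda>m. \<Sum>n. x n m)"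
    and "(\<lambda>n. \<Sum>m. x n m) sums (\<Sum>m. \<Sum>n. x n m)"
proof -
  show rows: "summable (\<lambda>m. x n m)" for n
    by (rule summable_comparison_test'[where g = "\<lambda>m. \<alpha> n * \<beta> m" and N = 0])
       (auto intro: bound summable_mult \<beta>)
  show cols: "summable (\<lambda>n. x n m)" for m
    by (rule summable_comparison_test'[where g = "\<lambda>n. \<alpha> n * \<beta> m" and N = 0])
       (auto intro: bound summable_mult2 \<alpha>)
  have nrows: "summable (\<lambda>m. norm (x n m))" for n
    by (rule summable_comparison_test'[where g = "\<lambda>m. \<alpha> n * \<beta> m" and N = 0])
       (auto intro: bound summable_mult \<beta>)
  have ncols: "summable (\<lambda>n. norm (x n m))" for m
    by (rule summable_comparison_test'[where g = "\<lambda>n. \<alpha> n * \<beta> m" and N = 0])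
       (auto intro: bound summable_mult2 \<alpha>)
  have row_le: "(\<Sum>m. norm (x n m)) \<le> \<alpha> n * suminf \<beta>" for n
    using suminf_le[OF bound nrows] suminf_mult[OF \<beta>] summable_mult[OF \<beta>] by metis
  have nn: "summable (\<lambda>n. \<Sum>m. norm (x n m))"
    by (rule summable_comparison_test'[where g = "\<lambda>n. \<alpha> n * suminf \<beta>" and N = 0])
       (auto intro: summable_mult2 \<alpha> row_le simp: suminf_nonneg nrows)
  have inner: "(\<Sum>\<^sub>\<infinity>m. norm (x n m)) = (\<Sum>m. norm (x n m))" for n
    by (intro infsumI norm_summable_imp_has_sum) (auto simp: nrows)
  have "(\<lambda>p. norm (case p of (n, m) \<Rightarrow> x n m)) summable_on (UNIV \<times> UNIV)"
    by (rule iffD2[OF Infinite_Sum.abs_summable_on_Sigma_iff])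
       (use nn nrows in \<open>auto simp: inner suminf_nonneg intro!: norm_summable_imp_summable_on\<close>)
  then have S: "(\<lambda>(n, m). x n m) summable_on UNIV \<times> UNIV"
    by (rule abs_summable_summable)
  then have S': "(\<lambda>(m, n). x n m) summable_on UNIV \<times> UNIV"
    by (subst summable_on_swap) (simp add: case_prod_unfold)
  have r: "(\<Sum>\<^sub>\<infinity>m. x n m) = (\<Sum>m. x n m)" for n
    by (intro infsumI norm_summable_imp_has_sum) (auto simp: nrows rows)
  have c: "(\<Sum>\<^sub>\<infinity>n. x n m) = (\<Sum>n. x n m)" for m
    by (intro infsumI norm_summable_imp_has_sum) (auto simp: ncols cols)
  have R: "((\<lambda>n. \<Sum>m. x n m) has_sum (\<Sum>\<^sub>\<infinity>n. \<Sum>\<^sub>\<infinity>m. x n m)) UNIV"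
    using summable_on_Sigma_banach[OF S] by (simp add: r)
  have C: "((\<lambda>m. \<Sum>n. x n m) has_sum (\<Sum>\<^sub>\<infinity>m. \<Sum>\<^sub>\<infinity>n. x n m)) UNIV"
    using summable_on_Sigma_banach[OF S'] by (simp add: c)
  have eq: "(\<Sum>\<^sub>\<infinity>n. \<Sum>\<^sub>\<infinity>m. x n m) = (\<Sum>\<^sub>\<infinity>m. \<Sum>\<^sub>\<infinity>n. x n m)"
    by (rule infsum_swap_banach[OF S])
  show "summable (\<lambda>m. \<Sum>n. x n m)"
    using has_sum_imp_sums[OF C] by (auto simp: sums_iff)
  show "(\<lambda>n. \<Sum>m. x n m) sums (\<Sum>m. \<Sum>n. x n m)"
    using has_sum_imp_sums[OF R] has_sum_imp_sums[OF C] eq by (auto simp: sums_iff)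
qed

lemma holomorphic_suminf:
  fixes F :: "nat \<Rightarrow> complex \<Rightarrow> complex"
  assumes hol: "\<And>n. F n holomorphic_on S" and S: "open S"
    and bound: "\<And>n z. z \<in> S \<Longrightarrow> norm (F n z) \<le> M n" and M: "summable M"
  shows "(\<lambda>z. \<Sum>n. F n z) holomorphic_on S"
proof (rule holomorphic_uniform_sequence[OF S])
  show "(\<lambda>z. \<Sum>i<n. F i z) holomorphic_on S" for n
    by (intro holomorphic_intros hol)
  have u: "uniform_limit S (\<lambda>n z. \<Sum>i<n. F i z) (\<lambda>z. \<Sum>n. F n z) sequentially"
    by (rule Weierstrass_m_test[OF bound M])
  show "\<exists>d>0. cball z d \<subseteq> S \<and>
      uniform_limit (cball z d) (\<lambda>n z. \<Sum>i<n. F i z) (\<lambda>z. \<Sum>n. F n z) sequentially"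
    if "z \<in> S" for z
    using S that u by (meson open_contains_cball uniform_limit_on_subset)
qed

lemma qpoch_0 [simp]: "qpoch a q 0 = 1"
  by (simp add: qpoch_def)

lemma qpoch_Suc: "qpoch a q (Suc n) = qpoch a q n * (1 - a * q ^ n)"
  by (simp add: qpoch_def)

lemma qpoch_add: "qpoch a q (m + n) = qpoch a q m * qpoch (a * q ^ m) q n"
  by (induction n) (simp_all add: qpoch_Suc power_add mult_ac)

lemma qpoch_Suc': "qpoch a q (Suc n) = (1 - a) * qpoch (a * q) q n"
  using qpoch_add[of a q 1 n] by (simp add: qpoch_Suc)

lemma qpoch_base_zero [simp]: "qpoch 0 q n = 1"
  by (simp add: qpoch_def)

lemma qpoch_inf_base_zero [simp]: "qpoch_inf 0 q = 1"
  by (simp add: qpoch_inf_def)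

locale nome =
  fixes q :: complex
  assumes q_nz: "0 < norm q" and q_lt_1: "norm q < 1"
begin

lemma q_neq_0 [simp]: "q \<noteq> 0"
  using q_nz by auto

lemma q_power_tendsto_0: "(\<lambda>n. a * q ^ n) \<longlonglongrightarrow> 0"
  using tendsto_mult_right_zero[OF LIMSEQ_power_zero[OF q_lt_1]] .

lemma norm_q_power_le_1: "norm q ^ n \<le> 1"
  using q_lt_1 by (intro power_le_one) auto

lemma norm_mult_q_power_le: "norm (a * q ^ n) \<le> norm a"
  using norm_q_power_le_1[of n] by (simp add: norm_mult norm_power mult_left_le)

lemma summable_q_power: "summable (\<lambda>n. norm q ^ n)"
  using q_lt_1 by (intro summable_geometric) auto

text \<open>
  Since \<open>\<Prod>\<^sub>j (1 + b \<bar>q\<bar>\<^sup>j) \<le> exp (b / (1 - \<bar>q\<bar>))\<close>, this number bounds all finite and infinite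
  q-shifted factorials whose base has modulus at most \<open>\<rho>\<close>.
\<close>

definition qpoch_bound :: "real \<Rightarrow> real" where
  "qpoch_bound \<rho> = exp (\<rho> / (1 - norm q))"

lemma qpoch_bound_pos [simp]: "qpoch_bound \<rho> > 0"
  by (simp add: qpoch_bound_def)

lemma prod_one_plus_le:
  assumes "0 \<le> b" "b \<le> \<rho>"
  shows "(\<Prod>j<n. 1 + b * norm q ^ j) \<le> qpoch_bound \<rho>"
proof -
  have "(\<Prod>j<n. 1 + b * norm q ^ j) \<le> (\<Prod>j<n. exp (b * norm q ^ j))"
    using assms by (intro prod_mono conjI exp_ge_add_one_self) auto
  also have "\<dots> = exp (b * (\<Sum>j<n. norm q ^ j))"
    by (simp add: exp_sum sum_distrib_left)
  also have "b * (\<Sum>j<n. norm q ^ j) \<le> \<rho> * (\<Sum>j. norm q ^ j)"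
    using assms by (intro mult_mono sum_le_suminf summable_q_power sum_nonneg) auto
  also have "(\<Sum>j. norm q ^ j) = 1 / (1 - norm q)"
    using q_lt_1 by (simp add: suminf_geometric)
  finally show ?thesis by (simp add: qpoch_bound_def)
qed

lemma norm_qpoch_le: "norm a \<le> \<rho> \<Longrightarrow> norm (qpoch a q n) \<le> qpoch_bound \<rho>"
proof -
  assume a: "norm a \<le> \<rho>"
  have "norm (qpoch a q n) = (\<Prod>j<n. norm (1 - a * q ^ j))"
    by (simp add: qpoch_def prod_norm)
  also have "\<dots> \<le> (\<Prod>j<n. 1 + norm a * norm q ^ j)"
  proof (intro prod_mono conjI)
    show "norm (1 - a * q ^ j) \<le> 1 + norm a * norm q ^ j" for j
      using norm_triangle_ineq4[of 1 "a * q ^ j"] by (simp add: norm_mult norm_power)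
  qed auto
  also have "\<dots> \<le> qpoch_bound \<rho>"
    using a by (intro prod_one_plus_le) auto
  finally show ?thesis .
qed

text \<open>
  The factor \<open>\<bar>q\<bar>\<close> to the power \<open>j\<^sup>2\<close> beats every geometric growth; this is why the left side for
  \<open>f = 1\<close> converges for all values of \<open>c\<close> and \<open>t\<close>.
\<close>

lemma summable_gaussian:
  assumes "0 \<le> M"
  shows "summable (\<lambda>j. M ^ j * norm q ^ (j * j))"
proof (rule summable_comparison_test_ev)
  have "(\<lambda>j. M * norm q ^ j) \<longlonglongrightarrow> M * 0"
    using q_lt_1 by (intro tendsto_intros LIMSEQ_power_zero) auto
  then have "eventually (\<lambda>j. M * norm q ^ j < 1 / 2) sequentially"
    by (intro order_tendstoD(2)[of _ "M * 0"]) auto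
  then show "eventually (\<lambda>j. norm (M ^ j * norm q ^ (j * j)) \<le> (1 / 2) ^ j) sequentially"
  proof eventually_elim
    case (elim j)
    have "M ^ j * norm q ^ (j * j) = (M * norm q ^ j) ^ j"
      by (simp add: power_mult_distrib power_mult)
    also have "\<dots> \<le> (1 / 2) ^ j"
      using elim assms by (intro power_mono) auto
    finally show ?case using assms by simp
  qed
  show "summable (\<lambda>j. (1 / 2 :: real) ^ j)"
    by (intro summable_geometric) auto
qed

lemma convergent_prod_qpoch: "convergent_prod (\<lambda>j. 1 - a * q ^ j)"
proof -
  have "summable (\<lambda>j. norm (- a * q ^ j))"
    using summable_mult[OF summable_q_power, of "norm a"] by (simp add: norm_mult norm_power)
  then have "convergent_prod (\<lambda>j. 1 + - a * q ^ j)"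
    by (intro abs_convergent_prod_imp_convergent_prod)
       (subst abs_convergent_prod_conv_summable, simp)
  then show ?thesis by simp
qed

lemma qpoch_tendsto: "qpoch a q \<longlonglongrightarrow> qpoch_inf a q"
  unfolding qpoch_def qpoch_inf_def
  using convergent_prod_LIMSEQ[OF convergent_prod_qpoch] by (simp add: LIMSEQ_lessThan_iff_atMost)

lemma norm_qpoch_inf_le: "norm a \<le> \<rho> \<Longrightarrow> norm (qpoch_inf a q) \<le> qpoch_bound \<rho>"
  using LIMSEQ_le_const2[OF tendsto_norm[OF qpoch_tendsto[of a]]] norm_qpoch_le by blast

lemma qpoch_inf_split: "qpoch_inf a q = qpoch a q n * qpoch_inf (a * q ^ n) q"
proof -
  have "(\<lambda>m. qpoch a q (n + m)) \<longlonglongrightarrow> qpoch_inf a q"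
    using LIMSEQ_ignore_initial_segment[OF qpoch_tendsto, of a n] by (simp add: add.commute)
  moreover have "(\<lambda>m. qpoch a q (n + m)) \<longlonglongrightarrow> qpoch a q n * qpoch_inf (a * q ^ n) q"
    unfolding qpoch_add by (intro tendsto_intros qpoch_tendsto)
  ultimately show ?thesis by (rule LIMSEQ_unique)
qed

lemma qpoch_inf_rec: "qpoch_inf a q = (1 - a) * qpoch_inf (a * q) q"
  using qpoch_inf_split[of a 1] by (simp add: qpoch_Suc)

lemma qpoch_inf_nonzero: "norm a < 1 \<Longrightarrow> qpoch_inf a q \<noteq> 0"
  unfolding qpoch_inf_def
proof (rule prodinf_nonzero[OF convergent_prod_qpoch])
  fix j assume "norm a < 1"
  then have "norm (a * q ^ j) < 1"
    using norm_mult_q_power_le order_le_less_trans by blast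
  then show "1 - a * q ^ j \<noteq> 0" by auto
qed

lemma qpoch_inf_q_nonzero [simp]: "qpoch_inf q q \<noteq> 0"
  by (rule qpoch_inf_nonzero[OF q_lt_1])

lemma qpoch_nonzero: "qpoch_inf a q \<noteq> 0 \<Longrightarrow> qpoch a q n \<noteq> 0"
  using qpoch_inf_split[of a n] by auto

lemma qpoch_q_nonzero [simp]: "qpoch q q n \<noteq> 0"
  by (simp add: qpoch_nonzero)

lemma qpoch_inf_shift: "qpoch a q n \<noteq> 0 \<Longrightarrow> qpoch_inf (a * q ^ n) q = qpoch_inf a q / qpoch a q n"
  using qpoch_inf_split[of a n] by auto

lemma qpoch_inf_shift_nonzero: "qpoch_inf a q \<noteq> 0 \<Longrightarrow> qpoch_inf (a * q ^ n) q \<noteq> 0"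
  using qpoch_inf_split[of a n] by auto

text \<open>
  The tail formula \<open>1 / (a)\<^sub>n = (a q\<^sup>n)\<^sub>\<infinity> / (a)\<^sub>\<infinity>\<close> turns a lower bound for finite products into an
  upper bound for infinite ones.
\<close>

lemma norm_inverse_qpoch_le:
  assumes "norm a \<le> \<rho>" "qpoch_inf a q \<noteq> 0"
  shows "norm (1 / qpoch a q n) \<le> qpoch_bound \<rho> / norm (qpoch_inf a q)"
proof -
  have "norm (a * q ^ n) \<le> \<rho>"
    using assms(1) norm_mult_q_power_le order_trans by blast
  then have "norm (qpoch_inf (a * q ^ n) q) \<le> qpoch_bound \<rho>"
    by (rule norm_qpoch_inf_le)
  moreover have "1 / qpoch a q n = qpoch_inf (a * q ^ n) q / qpoch_inf a q"
    using qpoch_inf_split[of a n] assms(2) by (auto simp: field_simps)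
  ultimately show ?thesis
    by (simp add: norm_divide divide_right_mono)
qed

definition inv_bound :: real where
  "inv_bound = qpoch_bound 1 / norm (qpoch_inf q q)"

lemma inv_bound_pos: "inv_bound > 0"
  by (simp add: inv_bound_def)

lemma norm_inverse_qpoch_q_le: "norm (1 / qpoch q q n) \<le> inv_bound"
  unfolding inv_bound_def using q_lt_1 by (intro norm_inverse_qpoch_le) auto

text \<open>
  The partial products telescope into a series of polynomials in \<open>a\<close> with a geometric majorant.
\<close>

lemma holomorphic_qpoch_inf_ball: "(\<lambda>a. qpoch_inf a q) holomorphic_on ball 0 \<rho>"
proof -
  have eq: "qpoch_inf a q = 1 + (\<Sum>n. qpoch a q n * (- a * q ^ n))" for a
  proof -
    have "(\<lambda>n. qpoch a q (Suc n) - qpoch a q n) sums (qpoch_inf a q - qpoch a q 0)"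
      by (rule telescope_sums[OF qpoch_tendsto])
    then show ?thesis
      by (simp add: sums_iff qpoch_Suc algebra_simps)
  qed
  have "(\<lambda>a. \<Sum>n. qpoch a q n * (- a * q ^ n)) holomorphic_on ball 0 \<rho>"
  proof (rule holomorphic_suminf)
    show "(\<lambda>a. qpoch a q n * (- a * q ^ n)) holomorphic_on ball 0 \<rho>" for n
      unfolding qpoch_def by (intro holomorphic_intros)
    show "summable (\<lambda>n. qpoch_bound \<rho> * (\<rho> * norm q ^ n))"
      by (intro summable_mult summable_q_power)
    show "norm (qpoch a q n * (- a * q ^ n)) \<le> qpoch_bound \<rho> * (\<rho> * norm q ^ n)"
      if "a \<in> ball 0 \<rho>" for a n
      unfolding norm_mult norm_power norm_minus_cancel
      using that le_less_trans[OF norm_ge_zero, of a \<rho>]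
      by (intro mult_mono norm_qpoch_le mult_nonneg_nonneg) (auto intro: less_imp_le)
  qed auto
  then show ?thesis
    unfolding eq by (intro holomorphic_intros)
qed

lemma holomorphic_qpoch_inf [holomorphic_intros]:
  assumes "f holomorphic_on S"
  shows "(\<lambda>z. qpoch_inf (f z) q) holomorphic_on S"
proof -
  have "(\<lambda>a. qpoch_inf a q) field_differentiable at z" for z
    using holomorphic_qpoch_inf_ball[of "norm z + 1"]
    by (rule holomorphic_on_imp_differentiable_at) auto
  then have "(\<lambda>a. qpoch_inf a q) holomorphic_on UNIV"
    by (auto simp: holomorphic_on_def)
  from holomorphic_on_compose_gen[OF assms this] show ?thesis
    by (simp add: o_def)
qed

lemma tendsto_qpoch_inf:
  assumes "(f \<longlongrightarrow> a) F"
  shows "((\<lambda>x. qpoch_inf (f x) q) \<longlongrightarrow> qpoch_inf a q) F"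
proof -
  have "continuous_on UNIV (\<lambda>a. qpoch_inf a q)"
    by (intro holomorphic_on_imp_continuous_on holomorphic_intros)
  then have "isCont (\<lambda>a. qpoch_inf a q) a"
    by (simp add: continuous_on_eq_continuous_at)
  then show ?thesis using assms by (rule isCont_tendsto_compose)
qed

text \<open>
  The power series \<open>F\<close> on the left satisfies \<open>(1 - w) F w = (1 - a w) F (q w)\<close> by the recurrence of
  its coefficients. Iterating this pushes the argument to \<open>0\<close>, where \<open>F\<close> is continuous with value
  \<open>1\<close>.
\<close>

theorem q_binomial:
  assumes z: "norm z < 1"
  shows "(\<lambda>n. qpoch a q n / qpoch q q n * z ^ n) sums (qpoch_inf (a * z) q / qpoch_inf z q)"
proof -
  define c where "c n = qpoch a q n / qpoch q q n" for n
  define F where "F w = (\<Sum>n. c n * w ^ n)" for w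
  define B where "B = qpoch_bound (norm a) * inv_bound"
  have c_le: "norm (c n) \<le> B" for n
    unfolding c_def B_def divide_inverse norm_mult
    using norm_inverse_qpoch_q_le[of n]
    by (intro mult_mono norm_qpoch_le) (auto simp: divide_inverse less_imp_le)
  have summ: "summable (\<lambda>n. c n * w ^ n)" if "norm w < 1" for w
  proof (rule summable_comparison_test'[where N = 0])
    show "summable (\<lambda>n. B * norm w ^ n)"
      using that by (intro summable_mult summable_geometric) auto
    show "norm (c n * w ^ n) \<le> B * norm w ^ n" for n
      by (simp add: norm_mult norm_power c_le mult_right_mono)
  qed
  have c_rec: "c (Suc n) * (1 - q ^ Suc n) = c n * (1 - a * q ^ n)" for n
  proof -
    have "qpoch q q (Suc n) = qpoch q q n * (1 - q ^ Suc n)"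
      by (simp add: qpoch_Suc)
    moreover have "1 - q ^ Suc n \<noteq> 0"
      using qpoch_q_nonzero[of "Suc n"] calculation by auto
    ultimately show ?thesis
      by (simp add: c_def qpoch_Suc)
  qed
  \<comment> \<open>The q-difference equation of the series, from \<open>c_rec\<close>.\<close>
  have F_rec: "(1 - w) * F w = (1 - a * w) * F (q * w)" if w: "norm w < 1" for w
  proof -
    have qw: "norm (q * w) < 1"
      using w q_lt_1 by (metis mult_less_cancel_right2 norm_ge_zero norm_mult order_le_less_trans 
          mult_left_le mult.commute less_imp_le)
    have S1: "(\<lambda>n. c n * w ^ n) sums F w" and S2: "(\<lambda>n. c n * (q * w) ^ n) sums F (q * w)"
      unfolding F_def using summ[OF w] summ[OF qw] by (simp_all add: summable_sums)
    have "(\<lambda>n. c n * w ^ n - c n * (q * w) ^ n) sums (F w - F (q * w))"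
      by (rule sums_diff[OF S1 S2])
    then have "(\<lambda>n. c (Suc n) * w ^ Suc n - c (Suc n) * (q * w) ^ Suc n) sums (F w - F (q * w))"
      by (subst sums_Suc_iff) simp
    also have "(\<lambda>n. c (Suc n) * w ^ Suc n - c (Suc n) * (q * w) ^ Suc n)
        = (\<lambda>n. w * (c n * w ^ n) - a * w * (c n * (q * w) ^ n))"
    proof
      fix n
      have "c (Suc n) * w ^ Suc n - c (Suc n) * (q * w) ^ Suc n
          = (c (Suc n) * (1 - q ^ Suc n)) * w ^ Suc n"
        by (simp add: algebra_simps power_mult_distrib)
      also have "\<dots> = w * (c n * w ^ n) - a * w * (c n * (q * w) ^ n)"
        unfolding c_rec by (simp add: algebra_simps power_mult_distrib)
      finally show "c (Suc n) * w ^ Suc n - c (Suc n) * (q * w) ^ Suc n =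
        w * (c n * w ^ n) - a * w * (c n * (q * w) ^ n)" .
    qed
    finally have "F w - F (q * w) = w * F w - a * w * F (q * w)"
      using sums_unique2 sums_diff[OF sums_mult[OF S1] sums_mult[OF S2]] by blast
    then show ?thesis by (simp add: algebra_simps)
  qed
  have iter: "qpoch z q n * F z = qpoch (a * z) q n * F (z * q ^ n)" for n
  proof (induction n)
    case (Suc n)
    have "norm (z * q ^ n) < 1"
      using z norm_mult_q_power_le order_le_less_trans by blast
    then have "(1 - z * q ^ n) * F (z * q ^ n) = (1 - a * z * q ^ n) * F (z * q ^ Suc n)"
      using F_rec by (simp add: mult_ac)
    with Suc show ?case
      by (simp add: qpoch_Suc) (metis mult.assoc mult.commute)
  qed simp
  have F_cont: "isCont F 0"
    unfolding F_def using summ[of "1/2"] by (intro isCont_powser[where K = "1/2"]) (auto simp: field_simps norm_divide)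
  have "(\<lambda>n. qpoch (a * z) q n * F (z * q ^ n)) \<longlonglongrightarrow> qpoch_inf (a * z) q * F 0"
    by (intro tendsto_intros qpoch_tendsto isCont_tendsto_compose[OF F_cont] q_power_tendsto_0)
  moreover have "(\<lambda>n. qpoch z q n * F z) \<longlonglongrightarrow> qpoch_inf z q * F z"
    by (intro tendsto_intros qpoch_tendsto)
  ultimately have "qpoch_inf z q * F z = qpoch_inf (a * z) q * F 0"
    unfolding iter by (rule LIMSEQ_unique[rotated])
  moreover have "F 0 = 1"
    unfolding F_def by (subst powser_zero) (simp add: c_def)
  ultimately have "F z = qpoch_inf (a * z) q / qpoch_inf z q"
    using qpoch_inf_nonzero[OF z] by (auto simp: field_simps)
  then show ?thesis
    using summable_sums[OF summ[OF z]] by (simp add: F_def c_def)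
qed

section \<open>The two sides as functionals, and their common reduction rule\<close>

definition theta :: "complex \<Rightarrow> complex" where
  "theta t = qpoch_inf q q * qpoch_inf t q * qpoch_inf (q / t) q"

text \<open>
  The integrand without \<open>f\<close>. For \<open>c = 0\<close> it is the weight \<open>(sq/t, sq)\<^sub>\<infinity>\<close> of the
  Al-Salam--Carlitz polynomials.
\<close>

definition weight :: "complex \<Rightarrow> complex \<Rightarrow> complex \<Rightarrow> complex" where
  "weight c t s = qpoch_inf (s * q / t) q * qpoch_inf (s * q) q * qpoch_inf (c * t * s) q
     / qpoch_inf (c * s\<^sup>2) q"

definition jackson :: "complex \<Rightarrow> complex \<Rightarrow> (complex \<Rightarrow> complex) \<Rightarrow> complex" where
  "jackson c t f = q_integral q t 1 (\<lambda>s. weight c t s * f s)"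

definition delta_term :: "complex \<Rightarrow> complex \<Rightarrow> (complex \<Rightarrow> complex) \<Rightarrow> nat \<Rightarrow> complex" where
  "delta_term c t f n = qpoch c q n / qpoch q q n * t ^ n * q_Delta q c f n"

definition transform_identity :: "complex \<Rightarrow> complex \<Rightarrow> (complex \<Rightarrow> complex) \<Rightarrow> bool" where
  "transform_identity c t f \<longleftrightarrow> delta_term c t f sums (qpoch_inf c q / theta t * jackson c t f)"

text \<open>
  No denominator vanishes. Nonvanishing at the end points \<open>s = 1\<close> and \<open>s = t\<close> suffices, because
  \<open>(a q\<^sup>n)\<^sub>\<infinity>\<close> is a factor of \<open>(a)\<^sub>\<infinity>\<close>.
\<close>

definition admissible :: "complex \<Rightarrow> complex \<Rightarrow> bool" where
  "admissible c t \<longleftrightarrow> t \<noteq> 0 \<and> theta t \<noteq> 0 \<and> qpoch_inf c q \<noteq> 0 \<and> qpoch_inf (c * t\<^sup>2) q \<noteq> 0"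

definition bounded_on_grid :: "complex \<Rightarrow> (complex \<Rightarrow> complex) \<Rightarrow> bool" where
  "bounded_on_grid t f \<longleftrightarrow> (\<exists>B. \<forall>n. norm (f (q ^ n)) \<le> B \<and> norm (f (t * q ^ n)) \<le> B)"

definition endpoint_term ::
  "complex \<Rightarrow> complex \<Rightarrow> complex \<Rightarrow> (complex \<Rightarrow> complex) \<Rightarrow> nat \<Rightarrow> complex" where
  "endpoint_term c t u f n = u * q ^ n * (weight c t (u * q ^ n) * f (u * q ^ n))"

lemma theta_mult_q: "t \<noteq> 0 \<Longrightarrow> theta (t * q) = - theta t / t"
  unfolding theta_def
  by (subst qpoch_inf_rec[of t], subst qpoch_inf_rec[of "q / (t * q)"]) (simp add: field_simps)

lemma theta_divide_q: "t \<noteq> 0 \<Longrightarrow> theta (t / q) = - (t / q) * theta t"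
  using theta_mult_q[of "t / q"] by (simp add: field_simps)

text \<open>
  The number \<open>c * t\<^sup>2\<close> is invariant under the parameter change of the reduction rule.
\<close>

lemma admissible_shift:
  assumes "admissible c t"
  shows "admissible (c * q\<^sup>2) (t / q)"
proof -
  have "c * q\<^sup>2 * (t / q)\<^sup>2 = c * t\<^sup>2"
    by (simp add: power_divide)
  then have "qpoch_inf (c * q\<^sup>2 * (t / q)\<^sup>2) q \<noteq> 0"
    using assms by (simp only: admissible_def not_False_eq_True)
  moreover have "qpoch_inf (c * q\<^sup>2) q \<noteq> 0"
    using assms by (intro qpoch_inf_shift_nonzero) (simp add: admissible_def)
  ultimately show ?thesis
    using assms theta_divide_q[of t] unfolding admissible_def by auto
qed

lemma admissible_zero: "admissible 0 t \<longleftrightarrow> t \<noteq> 0 \<and> theta t \<noteq> 0"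
  by (simp add: admissible_def)

lemma weight_bounded:
  assumes "qpoch_inf (c * u\<^sup>2) q \<noteq> 0"
  shows "\<exists>K>0. \<forall>n. norm (weight c t (u * q ^ n)) \<le> K"
proof -
  define D where "D = norm (qpoch_inf (c * u\<^sup>2) q)"
  have D: "D > 0" using assms by (simp add: D_def)
  define K where "K = qpoch_bound (norm (u * q / t)) * qpoch_bound (norm (u * q)) *
    qpoch_bound (norm (c * t * u)) * (qpoch_bound (norm (c * u\<^sup>2)) / D)"
  note small = norm_mult_q_power_le
  have "norm (weight c t (u * q ^ n)) \<le> K" for n
  proof -
    have arg: "c * (u * q ^ n)\<^sup>2 = (c * u\<^sup>2) * q ^ (2 * n)"
      by (simp add: power_mult_distrib power_mult [symmetric] mult.commute)
    have "norm (inverse (qpoch_inf (c * (u * q ^ n)\<^sup>2) q)) \<le> qpoch_bound (norm (c * u\<^sup>2)) / D"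
      unfolding arg qpoch_inf_shift[OF qpoch_nonzero[OF assms]]
      by (simp add: norm_divide norm_inverse D_def divide_right_mono norm_qpoch_le divide_inverse[symmetric])
    moreover have "norm (qpoch_inf (u * q ^ n * q / t) q) \<le> qpoch_bound (norm (u * q / t))"
      using small[of "u * q / t" n] by (intro norm_qpoch_inf_le) (simp add: mult_ac)
    moreover have "norm (qpoch_inf (u * q ^ n * q) q) \<le> qpoch_bound (norm (u * q))"
      using small[of "u * q" n] by (intro norm_qpoch_inf_le) (simp add: mult_ac)
    moreover have "norm (qpoch_inf (c * t * (u * q ^ n)) q) \<le> qpoch_bound (norm (c * t * u))"
      using small[of "c * t * u" n] by (intro norm_qpoch_inf_le) (simp add: mult_ac)
    ultimately show ?thesis
      unfolding weight_def divide_inverse norm_mult K_def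
      by (intro mult_mono mult_nonneg_nonneg) (auto simp: D_def less_imp_le)
  qed
  moreover have "K > 0"
    using D by (simp add: K_def)
  ultimately show ?thesis by blast
qed

lemma summable_endpoint_term:
  assumes "qpoch_inf (c * u\<^sup>2) q \<noteq> 0" and f: "\<And>n. norm (f (u * q ^ n)) \<le> B"
  shows "summable (endpoint_term c t u f)"
proof -
  obtain K where K: "\<And>n. norm (weight c t (u * q ^ n)) \<le> K" "K > 0"
    using weight_bounded[OF assms(1), of t] by blast
  show ?thesis
  proof (rule summable_comparison_test'[where N = 0])
    show "summable (\<lambda>n. norm u * norm q ^ n * (K * B))"
      by (intro summable_mult2 summable_mult summable_q_power)
    show "norm (endpoint_term c t u f n) \<le> norm u * norm q ^ n * (K * B)" for n
      unfolding endpoint_term_def norm_mult norm_power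
      using K by (intro mult_mono f order_refl mult_nonneg_nonneg) (auto intro: less_imp_le)
  qed
qed

text \<open>
  For a function that is bounded on the nodes, the sums over the two geometric progressions converge
  separately, so that they can be shifted independently.
\<close>

lemma jackson_split:
  assumes "admissible c t" and "bounded_on_grid t f"
  shows "summable (endpoint_term c t 1 f)" and "summable (endpoint_term c t t f)"
    and "q_integrable q t 1 (\<lambda>s. weight c t s * f s)"
    and "jackson c t f = suminf (endpoint_term c t 1 f) - suminf (endpoint_term c t t f)"
proof -
  obtain B where B: "\<And>n. norm (f (1 * q ^ n)) \<le> B" "\<And>n. norm (f (t * q ^ n)) \<le> B"
    using assms(2) by (auto simp: bounded_on_grid_def)
  show s1: "summable (endpoint_term c t 1 f)"
    using assms(1) by (intro summable_endpoint_term[where B = B] B(1)) (simp add: admissible_def)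
  show s2: "summable (endpoint_term c t t f)"
    using assms(1) by (intro summable_endpoint_term[where B = B] B(2)) (simp add: admissible_def)
  have eq: "q_integral_term q t 1 (\<lambda>s. weight c t s * f s) =
      (\<lambda>n. endpoint_term c t 1 f n - endpoint_term c t t f n)"
    by (simp add: q_integral_term_def endpoint_term_def fun_eq_iff)
  show "q_integrable q t 1 (\<lambda>s. weight c t s * f s)"
    unfolding q_integrable_def eq by (intro summable_diff s1 s2)
  show "jackson c t f = suminf (endpoint_term c t 1 f) - suminf (endpoint_term c t t f)"
    unfolding jackson_def q_integral_def eq by (rule suminf_diff[OF s1 s2, symmetric])
qed

lemma bounded_on_grid_continuous:
  assumes "continuous_on (cball 0 (max 1 (norm t))) f"
  shows "bounded_on_grid t f"
proof -
  have "bounded (f ` cball 0 (max 1 (norm t)))"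
    by (intro compact_imp_bounded compact_continuous_image assms compact_cball)
  then obtain B where B: "\<And>s. norm s \<le> max 1 (norm t) \<Longrightarrow> norm (f s) \<le> B"
    by (force simp: bounded_iff)
  have "norm (q ^ n) \<le> max 1 (norm t)" "norm (t * q ^ n) \<le> max 1 (norm t)" for n
    using norm_q_power_le_1[of n] mult_left_le[of "norm q ^ n" "norm t"]
    by (auto simp: norm_mult norm_power le_max_iff_disj)
  with B show ?thesis
    unfolding bounded_on_grid_def by blast
qed

lemma bounded_on_grid_mult:
  assumes "bounded_on_grid t f" "bounded_on_grid t g"
  shows "bounded_on_grid t (\<lambda>s. f s * g s)"
proof -
  obtain A B where A: "\<And>n. norm (f (q ^ n)) \<le> A" "\<And>n. norm (f (t * q ^ n)) \<le> A"
    and B: "\<And>n. norm (g (q ^ n)) \<le> B" "\<And>n. norm (g (t * q ^ n)) \<le> B"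
    using assms unfolding bounded_on_grid_def by metis
  have "A \<ge> 0" "B \<ge> 0"
    using A(1)[of 0] B(1)[of 0] norm_ge_zero order_trans by blast+
  then show ?thesis
    unfolding bounded_on_grid_def norm_mult
    by (intro exI[of _ "A * B"] allI conjI mult_mono A B) auto
qed

lemma jackson_linear:
  assumes "admissible c t" "bounded_on_grid t f" "bounded_on_grid t g"
  shows "jackson c t (\<lambda>s. a * f s + g s) = a * jackson c t f + jackson c t g"
proof -
  have eq: "q_integral_term q t 1 (\<lambda>s. weight c t s * (a * f s + g s)) =
      (\<lambda>n. a * q_integral_term q t 1 (\<lambda>s. weight c t s * f s) n +
        q_integral_term q t 1 (\<lambda>s. weight c t s * g s) n)"
    by (simp add: q_integral_term_def fun_eq_iff algebra_simps)
  show ?thesis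
    unfolding jackson_def q_integral_def eq
    using jackson_split(3)[OF assms(1,2)] jackson_split(3)[OF assms(1,3)]
    by (simp add: q_integrable_def suminf_add[symmetric] suminf_mult summable_mult)
qed

lemma transform_identity_linear:
  assumes "admissible c t" "bounded_on_grid t f" "bounded_on_grid t g"
    and "transform_identity c t f" "transform_identity c t g"
  shows "transform_identity c t (\<lambda>s. a * f s + g s)"
proof -
  have "delta_term c t (\<lambda>s. a * f s + g s) = (\<lambda>n. a * delta_term c t f n + delta_term c t g n)"
    by (simp add: delta_term_def q_Delta_def fun_eq_iff sum_distrib_left sum.distrib
        add_divide_distrib algebra_simps)
  moreover have "(\<lambda>n. a * delta_term c t f n + delta_term c t g n) sums
      (a * (qpoch_inf c q / theta t * jackson c t f) + qpoch_inf c q / theta t * jackson c t g)"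
    using assms(4,5) unfolding transform_identity_def by (intro sums_add sums_mult)
  ultimately show ?thesis
    unfolding transform_identity_def jackson_linear[OF assms(1-3)]
    by (simp add: distrib_left mult.left_commute)
qed

lemma q_power_neq_1 [simp]: "q * q ^ n \<noteq> 1" "q ^ n * q \<noteq> 1"
  using qpoch_q_nonzero[of "Suc n"] by (auto simp: qpoch_Suc mult.commute simp del: qpoch_q_nonzero)

lemma q_Delta_one_minus_0: "q_Delta q c (\<lambda>s. (1 - s) * h s) 0 = 0"
  by (simp add: q_Delta_def)

text \<open>
  The factor \<open>1 - q ^ k\<close> removes the term \<open>k = 0\<close> and cancels the last factor of \<open>(q;q)\<^sub>k\<close>; the first
  factors of the two numerators come out of the sum, and what remains is again of the form
  \<open>\<Delta>\<close>.
\<close>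

lemma q_Delta_one_minus_Suc:
  "q_Delta q c (\<lambda>s. (1 - s) * h s) (Suc n) =
     (1 - inverse q ^ Suc n) * (1 - c * q ^ Suc n) * q * q_Delta q (c * q\<^sup>2) (\<lambda>s. h (q * s)) n"
proof -
  have [simp]: "inverse q * inverse q ^ n * q = inverse q ^ n"
    by (simp add: field_simps)
  have c: "c * q ^ Suc n * q = c * q\<^sup>2 * q ^ n"
    by (simp add: power2_eq_square)
  have "qpochs [inverse q ^ Suc n, c * q ^ Suc n] q (Suc k) / qpoch q q (Suc k) *
      ((1 - q ^ Suc k) * h (q ^ Suc k)) * q ^ Suc k =
    (1 - inverse q ^ Suc n) * (1 - c * q ^ Suc n) * q *
      (qpochs [inverse q ^ n, c * q\<^sup>2 * q ^ n] q k / qpoch q q k * h (q * q ^ k) * q ^ k)" for k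
    unfolding qpochs_def list.map prod_list.Cons prod_list.Nil
      qpoch_Suc'[of "inverse q ^ Suc n"] qpoch_Suc'[of "c * q ^ Suc n"] qpoch_Suc[of q] c
    by (simp add: field_simps)
  then show ?thesis
    unfolding q_Delta_def by (subst sum.atMost_Suc_shift) (simp add: sum_distrib_left)
qed

lemma delta_term_one_minus:
  "delta_term c t (\<lambda>s. (1 - s) * h s) (Suc n) =
     - t * (1 - c) * (1 - c * q) * delta_term (c * q\<^sup>2) (t / q) (\<lambda>s. h (q * s)) n"
proof -
  have "qpoch c q (Suc n) * (1 - c * q ^ Suc n) = qpoch c q (2 + n)"
    by (simp add: qpoch_Suc)
  also have "\<dots> = (1 - c) * (1 - c * q) * qpoch (c * q\<^sup>2) q n"
    unfolding qpoch_add by (simp add: qpoch_Suc numeral_2_eq_2)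
  finally have c: "qpoch c q (Suc n) * (1 - c * q ^ Suc n) = 
     (1 - c) * (1 - c * q) * qpoch (c * q\<^sup>2) q n" .
  have i: "1 - inverse q ^ Suc n = - (1 - q * q ^ n) / (q * q ^ n)"
    by (simp add: field_simps)
  have "delta_term c t (\<lambda>s. (1 - s) * h s) (Suc n) =
      (qpoch c q (Suc n) * (1 - c * q ^ Suc n)) / (qpoch q q n * (1 - q * q ^ n)) * t ^ Suc n * 
      ((- (1 - q * q ^ n) / (q * q ^ n)) * q * q_Delta q (c * q\<^sup>2) (\<lambda>s. h (q * s)) n)"
    unfolding delta_term_def q_Delta_one_minus_Suc i by (simp add: qpoch_Suc)
  also have "\<dots> = - t * (1 - c) * (1 - c * q) * delta_term (c * q\<^sup>2) (t / q) (\<lambda>s. h (q * s)) n"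
    unfolding c delta_term_def by (simp add: field_simps)
  finally show ?thesis .
qed

lemma weight_one_minus: "t \<noteq> 0 \<Longrightarrow> (1 - q * s) * weight c t (q * s) = weight (c * q\<^sup>2) (t / q) s"
proof -
  assume t: "t \<noteq> 0"
  have arg: "c * (q * s)\<^sup>2 = c * q\<^sup>2 * s\<^sup>2" "c * t * (q * s) = c * q\<^sup>2 * (t / q) * s"
    "q * s * q / t = s * q / (t / q)" "q * s = s * q"
    using t by (simp_all add: power2_eq_square field_simps)
  show ?thesis
    unfolding weight_def arg(1-3) qpoch_inf_rec[of "s * q"] unfolding arg(4) by simp
qed

text \<open>
  The upper sum loses its term \<open>s = 1\<close> and the lower sum starts at \<open>t = q * (t / q)\<close>, so both become
  sums for the lower end point \<open>t / q\<close> after \<open>s \<mapsto> q * s\<close>.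
\<close>

lemma jackson_one_minus:
  assumes adm: "admissible c t" and h: "bounded_on_grid t h"
  shows "jackson c t (\<lambda>s. (1 - s) * h s) = q * jackson (c * q\<^sup>2) (t / q) (\<lambda>s. h (q * s))"
proof -
  have t: "t \<noteq> 0" using adm by (simp add: admissible_def)
  obtain B where B: "\<And>n. norm (h (q ^ n)) \<le> B" "\<And>n. norm (h (t * q ^ n)) \<le> B"
    using h by (auto simp: bounded_on_grid_def)
  have f: "bounded_on_grid t (\<lambda>s. (1 - s) * h s)"
    by (intro bounded_on_grid_mult h bounded_on_grid_continuous continuous_intros)
  have h': "bounded_on_grid (t / q) (\<lambda>s. h (q * s))"
    unfolding bounded_on_grid_def
  proof (intro exI[of _ B] allI conjI)
    show "norm (h (q * q ^ n)) \<le> B" for n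
      using B(1)[of "Suc n"] by simp
    show "norm (h (q * (t / q * q ^ n))) \<le> B" for n
      using B(2)[of n] by simp
  qed
  have term1: "endpoint_term c t 1 (\<lambda>s. (1 - s) * h s) (Suc n) =
      q * endpoint_term (c * q\<^sup>2) (t / q) 1 (\<lambda>s. h (q * s)) n" for n
    using weight_one_minus[OF t, of "q ^ n" c, symmetric] by (simp add: endpoint_term_def mult_ac)
  have termt: "endpoint_term c t t (\<lambda>s. (1 - s) * h s) n =
      q * endpoint_term (c * q\<^sup>2) (t / q) (t / q) (\<lambda>s. h (q * s)) n" for n
    using weight_one_minus[OF t, of "t / q * q ^ n" c, symmetric] by (simp add: endpoint_term_def mult_ac)
  note S = jackson_split[OF adm f] and S' = jackson_split[OF admissible_shift[OF adm] h']
  have "suminf (endpoint_term c t 1 (\<lambda>s. (1 - s) * h s)) =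
      (\<Sum>n. endpoint_term c t 1 (\<lambda>s. (1 - s) * h s) (Suc n))"
    using suminf_split_head[OF S(1)] by (simp add: endpoint_term_def)
  then show ?thesis
    unfolding S(4) S'(4)
    by (simp add: term1 termt[abs_def] suminf_mult S'(1,2) right_diff_distrib)
qed

lemma transform_identity_one_minus:
  assumes adm: "admissible c t" and h: "bounded_on_grid t h"
    and "transform_identity (c * q\<^sup>2) (t / q) (\<lambda>s. h (q * s))"
  shows "transform_identity c t (\<lambda>s. (1 - s) * h s)"
proof -
  let ?J = "jackson (c * q\<^sup>2) (t / q) (\<lambda>s. h (q * s))"
  have t: "t \<noteq> 0" using adm by (simp add: admissible_def)
  have "(\<lambda>n. delta_term c t (\<lambda>s. (1 - s) * h s) (Suc n)) sums
      (- t * (1 - c) * (1 - c * q) * (qpoch_inf (c * q\<^sup>2) q / theta (t / q) * ?J))"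
    unfolding delta_term_one_minus
    using assms(3) by (intro sums_mult) (simp add: transform_identity_def)
  moreover have "delta_term c t (\<lambda>s. (1 - s) * h s) 0 = 0"
    by (simp add: delta_term_def q_Delta_one_minus_0)
  ultimately have "delta_term c t (\<lambda>s. (1 - s) * h s) sums
      (- t * (1 - c) * (1 - c * q) * (qpoch_inf (c * q\<^sup>2) q / theta (t / q) * ?J))"
    by (subst (asm) sums_Suc_iff) simp
  also have "- t * (1 - c) * (1 - c * q) * (qpoch_inf (c * q\<^sup>2) q / theta (t / q) * ?J) =
      qpoch_inf c q / theta t * (q * ?J)"
  proof -
    have "qpoch_inf c q = (1 - c) * (1 - c * q) * qpoch_inf (c * q\<^sup>2) q"
      using qpoch_inf_split[of c 2] by (simp add: qpoch_Suc numeral_2_eq_2)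
    moreover have "theta t \<noteq> 0" using adm by (simp add: admissible_def)
    ultimately show ?thesis
      unfolding theta_divide_q[OF t] using t by (simp add: divide_simps)
  qed
  finally show ?thesis
    by (simp add: transform_identity_def jackson_one_minus[OF adm h])
qed

text \<open>
  Induction on the degree along \<open>p s = p 1 + (1 - s) * h s\<close>. The parameters change in each step, so
  the identity for constants is needed for a whole family of values of \<open>c\<close> that is stable under
  multiplication by \<open>q\<^sup>2\<close>. The predicate \<open>P\<close> describes this family; it allows the two uses
  \<open>c = 0\<close> and \<open>c\<close> arbitrary.
\<close>

lemma transform_identity_poly:
  assumes base: "\<And>c t. P c \<Longrightarrow> admissible c t \<Longrightarrow> transform_identity c t (\<lambda>_. 1)"
    and shift: "\<And>c. P c \<Longrightarrow> P (c * q\<^sup>2)"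
    and "P c" "admissible c t"
  shows "transform_identity c t (poly p)"
  using assms(3,4)
proof (induction "degree p" arbitrary: p c t rule: less_induct)
  case less
  define h where "h = - synthetic_div p 1"
  have p: "poly p = (\<lambda>s. 1 * ((1 - s) * poly h s) + poly p 1)"
  proof
    fix s
    have "p + smult 1 (synthetic_div p 1) = pCons (poly p 1) (synthetic_div p 1)"
      by (rule synthetic_div_correct)
    then have "poly p s + poly (synthetic_div p 1) s = poly p 1 + s * poly (synthetic_div p 1) s"
      by (metis poly_add poly_pCons poly_smult mult_1)
    then show "poly p s = 1 * ((1 - s) * poly h s) + poly p 1"
      by (simp add: h_def algebra_simps)
  qed
  have cont: "continuous_on A (poly r)" for A and r :: "complex poly"
    by (intro continuous_intros)
  note bd = bounded_on_grid_continuous[OF cont]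
  have c1: "bounded_on_grid t (\<lambda>_. 1)" for t
    by (rule bounded_on_grid_continuous) auto
  have const: "transform_identity c t (\<lambda>_. poly p 1)"
  proof -
    have "transform_identity c t (\<lambda>_. 0)"
      by (simp add: transform_identity_def delta_term_def[abs_def] q_Delta_def jackson_def
          q_integral_def q_integral_term_def)
    then have "transform_identity c t (\<lambda>_. poly p 1 * 1 + 0)"
      by (intro transform_identity_linear less.prems base c1 bounded_on_grid_continuous) auto
    then show ?thesis by simp
  qed
  have rest: "transform_identity c t (\<lambda>s. (1 - s) * poly h s)"
  proof (cases "degree p = 0")
    case True
    then have "h = 0"
      by (simp add: h_def synthetic_div_eq_0_iff)
    then show ?thesis
      by (simp add: transform_identity_def delta_term_def[abs_def] q_Delta_def jackson_def
          q_integral_def q_integral_term_def)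
  next
    case False
    have "(\<lambda>s. poly h (q * s)) = poly (h \<circ>\<^sub>p [:0, q:])"
      by (simp add: poly_pcompose fun_eq_iff mult.commute)
    moreover have "degree (h \<circ>\<^sub>p [:0, q:]) < degree p"
      using False by (simp add: degree_pcompose h_def degree_synthetic_div)
    ultimately have "transform_identity (c * q\<^sup>2) (t / q) (\<lambda>s. poly h (q * s))"
      using less.hyps less.prems admissible_shift shift by auto
    then show ?thesis
      by (rule transform_identity_one_minus[OF less.prems(2) bd])
  qed
  show ?case
    by (subst p, rule transform_identity_linear[OF less.prems(2) _ _ rest const])
       (auto intro!: bounded_on_grid_continuous continuous_intros)
qed

section \<open>Evaluations of the finite sums\<close>

text \<open>
  Raising \<open>n\<close> by one applies the operator \<open>1 - q\<^sup>-\<^sup>n\<^sup>-\<^sup>1 E\<close>, where \<open>E\<close> is the shift of the sequence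
  \<open>x\<close>. This gives both summation formulas that follow by induction on \<open>n\<close>.
\<close>

lemma sum_qpoch_inverse_Suc:
  "(\<Sum>k\<le>Suc n. qpoch (inverse q ^ Suc n) q k / qpoch q q k * x k) =
   (\<Sum>k\<le>n. qpoch (inverse q ^ n) q k / qpoch q q k * (x k - inverse q ^ Suc n * x (Suc k)))"
proof -
  define A where "A n k = qpoch (inverse q ^ n) q k / qpoch q q k" for n k
  have rec: "A (Suc n) (Suc k) = A n (Suc k) - inverse q ^ Suc n * A n k" for k
  proof -
    have arg: "inverse q ^ Suc n * q = inverse q ^ n"
      by (simp add: field_simps)
    have [simp]: "1 - q * q ^ k \<noteq> 0"
      using q_power_neq_1(1)[of k] by (metis eq_iff_diff_eq_0)
    show ?thesis
      unfolding A_def qpoch_Suc'[of "inverse q ^ Suc n"] arg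
      by (simp add: qpoch_Suc divide_simps) (simp add: algebra_simps)
  qed
  \<comment> \<open>The last factor of \<open>(q\<^sup>-\<^sup>n)\<^sub>n\<^sub>+\<^sub>1\<close> vanishes, so the sum for \<open>n\<close> may be extended by one term.\<close>
  have "A n (Suc n) = 0"
    by (simp add: A_def qpoch_Suc field_simps)
  then have "(\<Sum>k\<le>n. A n k * x k) = (\<Sum>k\<le>Suc n. A n k * x k)"
    by simp
  also have "\<dots> = A n 0 * x 0 + (\<Sum>k\<le>n. A n (Suc k) * x (Suc k))"
    by (rule sum.atMost_Suc_shift)
  finally have "(\<Sum>k\<le>n. A n k * (x k - inverse q ^ Suc n * x (Suc k))) =
      A n 0 * x 0 + (\<Sum>k\<le>n. A n (Suc k) * x (Suc k)) -
      inverse q ^ Suc n * (\<Sum>k\<le>n. A n k * x (Suc k))"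
    by (simp add: right_diff_distrib sum_subtractf sum_distrib_left mult.left_commute)
  also have "\<dots> = A (Suc n) 0 * x 0 + (\<Sum>k\<le>n. A (Suc n) (Suc k) * x (Suc k))"
  proof -
    have "A (Suc n) 0 = A n 0" by (simp add: A_def)
    then show ?thesis
      unfolding rec by (simp add: left_diff_distrib sum_subtractf sum_distrib_left mult.assoc)
  qed
  also have "\<dots> = (\<Sum>k\<le>Suc n. A (Suc n) k * x k)"
    by (rule sum.atMost_Suc_shift[symmetric])
  finally show ?thesis by (simp add: A_def)
qed

text \<open>
  A limiting case of the q-Chu-Vandermonde sum, with lower parameter \<open>0\<close>.
\<close>

lemma q_vandermonde:
  "(\<Sum>k\<le>n. qpoch (inverse q ^ n) q k / qpoch q q k * (qpoch b q k * q ^ k)) = b ^ n"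
proof (induction n arbitrary: b)
  case (Suc n)
  have x: "qpoch b q k * q ^ k - inverse q ^ Suc n * (qpoch b q (Suc k) * q ^ Suc k) =
      qpoch b q k * q ^ k - inverse q ^ n * (1 - b) * (qpoch (b * q) q k * q ^ k)" for k
    unfolding qpoch_Suc'[of b] by (simp add: field_simps)
  have "(\<Sum>k\<le>n. qpoch (inverse q ^ n) q k / qpoch q q k *
      (qpoch b q k * q ^ k - inverse q ^ n * (1 - b) * (qpoch (b * q) q k * q ^ k)))
    = b ^ n - inverse q ^ n * (1 - b) * (b * q) ^ n"
    unfolding Suc.IH[of b, symmetric] Suc.IH[of "b * q", symmetric]
    by (simp add: right_diff_distrib sum_subtractf sum_distrib_left mult.left_commute mult.assoc)
  then show ?case
    unfolding sum_qpoch_inverse_Suc x by (simp add: field_simps power_mult_distrib)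
qed simp

lemma q_Delta_one: "q_Delta q c (\<lambda>_. 1) n = (c * q ^ n) ^ n"
  using q_vandermonde[of n "c * q ^ n"] by (simp add: q_Delta_def qpochs_def mult_ac)

text \<open>
  A q-analogue of the falling factorial. As a function of \<open>m\<close> it is the value of the functional
  \<open>\<Delta>\<^sub>n\<close> for \<open>c = 0\<close> at the monomial \<open>s\<^sup>m\<close>: up to a constant a divided difference of order \<open>n\<close>, which
  explains why it vanishes for \<open>m < n\<close>.
\<close>

definition q_falling :: "nat \<Rightarrow> nat \<Rightarrow> complex" where
  "q_falling n m = (if m < n then 0 else qpoch q q m / qpoch q q (m - n))"

lemma sum_qpoch_inverse_power:
  "(\<Sum>k\<le>n. qpoch (inverse q ^ n) q k / qpoch q q k * z ^ k) = (\<Prod>j<n. 1 - z * inverse q ^ Suc j)"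
proof (induction n)
  case (Suc n)
  have "(\<Sum>k\<le>Suc n. qpoch (inverse q ^ Suc n) q k / qpoch q q k * z ^ k) =
    (\<Sum>k\<le>n. qpoch (inverse q ^ n) q k / qpoch q q k * z ^ k) * (1 - z * inverse q ^ Suc n)"
    unfolding sum_qpoch_inverse_Suc sum_distrib_right
    by (intro sum.cong refl) (simp add: right_diff_distrib)
  then show ?case unfolding Suc by simp
qed simp

lemma sum_qpoch_inverse_q_power:
  "(\<Sum>k\<le>n. qpoch (inverse q ^ n) q k / qpoch q q k * q ^ (k * Suc m)) = q_falling n m"
proof -
  have "(\<Sum>k\<le>n. qpoch (inverse q ^ n) q k / qpoch q q k * q ^ (k * Suc m)) =
      (\<Prod>j<n. 1 - q ^ Suc m * inverse q ^ Suc j)"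
    unfolding sum_qpoch_inverse_power[symmetric] power_mult[symmetric] by (simp add: mult.commute)
  also have "\<dots> = q_falling n m"
  proof (cases "m < n")
    case True
    then have "(\<Prod>j<n. 1 - q ^ Suc m * inverse q ^ Suc j) = 0"
      by (intro prod_zero bexI[of _ m]) (auto simp: field_simps)
    then show ?thesis using True by (simp add: q_falling_def)
  next
    case False
    have "(\<Prod>j<n. 1 - q ^ Suc m * inverse q ^ Suc j) * qpoch q q (m - n) = qpoch q q m"
      using False
    proof (induction n)
      case (Suc n)
      have mn: "m - n = Suc (m - Suc n)" using Suc.prems by simp
      have "q ^ Suc m * inverse q ^ Suc n = q * q ^ (m - Suc n)"
      proof -
        have "q ^ Suc m = q * q ^ (m - Suc n) * q ^ Suc n"
          using Suc.prems by (simp flip: power_add power_Suc)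
        then show ?thesis by (simp add: field_simps)
      qed
      then have "qpoch q q (m - n) = qpoch q q (m - Suc n) * (1 - q ^ Suc m * inverse q ^ Suc n)"
        unfolding mn by (simp add: qpoch_Suc)
      then show ?case using Suc by (simp add: mult_ac)
    qed simp
    then show ?thesis using False by (simp add: q_falling_def field_simps)
  qed
  finally show ?thesis .
qed

lemma q_Delta_zero_power: "q_Delta q 0 (\<lambda>s. s ^ m) n = q_falling n m"
proof -
  have "q_Delta q 0 (\<lambda>s. s ^ m) n =
      (\<Sum>k\<le>n. qpoch (inverse q ^ n) q k / qpoch q q k * q ^ (k * Suc m))"
    unfolding q_Delta_def
    by (intro sum.cong refl) (simp add: qpochs_def power_add power_mult [symmetric] mult.commute)
  then show ?thesis by (simp only: sum_qpoch_inverse_q_power)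
qed

lemma norm_falling_le: "norm (q_falling n m) \<le> qpoch_bound 1 * inv_bound"
proof -
  have "norm (qpoch q q m / qpoch q q (m - n)) \<le> qpoch_bound 1 * inv_bound"
    unfolding divide_inverse norm_mult
    using norm_inverse_qpoch_q_le[of "m - n"] q_lt_1
    by (intro mult_mono norm_qpoch_le) (auto simp: divide_inverse less_imp_le)
  then show ?thesis
    using inv_bound_pos by (simp add: q_falling_def less_imp_le)
qed

section \<open>The case c = 0: total mass and moments of the Jackson integral\<close>

lemma weight_zero_mult_q:
  "t \<noteq> 0 \<Longrightarrow> weight 0 (t * q) s = (1 - s / t) * weight 0 t s"
proof -
  assume t: "t \<noteq> 0"
  have "s * q / (t * q) = s / t" "s / t * q = s * q / t" by simp_all
  then show ?thesis
    using qpoch_inf_rec[of "s / t"] by (simp add: weight_def)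
qed

lemma admissible_zero_mult_q: "admissible 0 t \<Longrightarrow> admissible 0 (t * q)"
  by (simp add: admissible_zero theta_mult_q)

lemma admissible_zero_mult_q_power: "admissible 0 t \<Longrightarrow> admissible 0 (t * q ^ N)"
proof (induction N)
  case (Suc N)
  then have "admissible 0 (t * q ^ N * q)"
    by (intro admissible_zero_mult_q) simp
  then show ?case by (simp add: mult_ac)
qed simp

lemma bounded_on_grid_mult_q: "bounded_on_grid t f \<Longrightarrow> bounded_on_grid (t * q) f"
  unfolding bounded_on_grid_def by (metis mult.assoc power_Suc)

text \<open>
  For \<open>c = 0\<close> the factor \<open>1 - s / t\<close> plays the same part at the lower end point as \<open>1 - s\<close> does at
  the upper one: it kills the node \<open>s = t\<close> and completes \<open>(sq/t)\<^sub>\<infinity>\<close> to \<open>(s/t)\<^sub>\<infinity>\<close>.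
\<close>

lemma jackson_zero_mult_q:
  assumes adm: "admissible 0 t" and p: "bounded_on_grid t p"
  shows "jackson 0 (t * q) p = jackson 0 t (\<lambda>s. (1 - s / t) * p s)"
proof -
  let ?F = "\<lambda>s. (1 - s / t) * p s"
  have t: "t \<noteq> 0" using adm by (simp add: admissible_def)
  have F: "bounded_on_grid t ?F"
    by (intro bounded_on_grid_mult p bounded_on_grid_continuous continuous_intros) (use t in auto)
  note S = jackson_split[OF adm F]
    and S' = jackson_split[OF admissible_zero_mult_q[OF adm] bounded_on_grid_mult_q[OF p]]
  have summand: "endpoint_term 0 (t * q) u p n = endpoint_term 0 t u ?F n" for u n
    by (simp add: endpoint_term_def weight_zero_mult_q t)
  have "endpoint_term 0 t t ?F (Suc n) = endpoint_term 0 (t * q) (t * q) p n" for n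
    using weight_zero_mult_q[OF t, of "t * q * q ^ n"] t by (simp add: endpoint_term_def mult_ac)
  moreover have "endpoint_term 0 t t ?F 0 = 0"
    by (simp add: endpoint_term_def t)
  ultimately have "suminf (endpoint_term 0 t t ?F) = suminf (endpoint_term 0 (t * q) (t * q) p)"
    using suminf_split_head[OF S(2)] by simp
  then show ?thesis
    unfolding S(4) S'(4) by (simp add: summand[abs_def])
qed

text \<open>
  With \<open>w\<close> the weight for \<open>c = 0\<close>, the relation \<open>w (s/q) = (1 - s) (1 - s/t) w s\<close> says that
  \<open>s * w s * (1 + t - s) / t = w s - w (s/q)\<close>. Both one-sided sums therefore telescope to
  \<open>w 0 - 0 = 1\<close>, and their difference is \<open>0\<close>.
\<close>

lemma jackson_zero_telescoping:
  assumes adm: "admissible 0 t"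
  shows "jackson 0 t (\<lambda>s. (1 + t - s) / t) = 0"
proof -
  let ?F = "\<lambda>s. (1 + t - s) / t"
  have t: "t \<noteq> 0" using adm by (simp add: admissible_def)
  have F: "bounded_on_grid t ?F"
    by (intro bounded_on_grid_continuous continuous_intros) (use t in auto)
  have "suminf (endpoint_term 0 t u ?F) = 1" if u: "u = 1 \<or> u = t" for u
  proof -
    \<comment> \<open>Indexed from \<open>u / q\<close>, one step above the end point, where \<open>w\<close> has the factor \<open>(1)\<^sub>\<infinity> = 0\<close>.\<close>
    define v where "v n = weight 0 t (u / q * q ^ n)" for n
    have "(\<lambda>n. weight 0 t (u / q * q ^ n)) \<longlonglongrightarrow> 1"
    proof -
      have "(\<lambda>n. qpoch_inf (u / q * q / t * q ^ n) q * qpoch_inf (u / q * q * q ^ n) q) 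
          \<longlonglongrightarrow> qpoch_inf 0 q * qpoch_inf 0 q"
        by (intro tendsto_intros tendsto_qpoch_inf q_power_tendsto_0)
      then show ?thesis by (simp add: weight_def mult_ac)
    qed
    then have "(\<lambda>n. v (Suc n) - v n) sums (1 - v 0)"
      unfolding v_def by (rule telescope_sums)
    moreover have "v 0 = 0"
      using u t qpoch_inf_rec[of 1] by (auto simp: v_def weight_def)
    moreover have "v (Suc n) - v n = endpoint_term 0 t u ?F n" for n
    proof -
      define s where "s = u * q ^ n"
      have "v n = qpoch_inf (s / t) q * qpoch_inf s q"
        by (simp add: v_def weight_def s_def)
      then have "v n = (1 - s / t) * (1 - s) * weight 0 t s"
        by (subst (asm) qpoch_inf_rec, subst (asm) qpoch_inf_rec[of s]) (simp add: weight_def)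
      moreover have "v (Suc n) = weight 0 t s"
        by (simp add: v_def s_def)
      moreover have "weight 0 t s - (1 - s / t) * (1 - s) * weight 0 t s =
          s * (weight 0 t s * ((1 + t - s) / t))"
        using t by (simp add: field_simps)
      ultimately show ?thesis
        by (simp add: endpoint_term_def s_def)
    qed
    ultimately show ?thesis by (simp add: sums_iff)
  qed
  then show ?thesis
    by (simp add: jackson_split(4)[OF adm F])
qed

lemma jackson_zero_one_mult_q:
  assumes adm: "admissible 0 t"
  shows "jackson 0 (t * q) (\<lambda>_. 1) = - jackson 0 t (\<lambda>_. 1) / t"
proof -
  have t: "t \<noteq> 0" using adm by (simp add: admissible_def)
  have one: "bounded_on_grid t (\<lambda>_. 1)"
    by (intro bounded_on_grid_continuous continuous_intros)
  have "jackson 0 (t * q) (\<lambda>_. 1) = jackson 0 t (\<lambda>s. (1 - s / t) * 1)"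
    by (rule jackson_zero_mult_q[OF adm one])
  also have "(\<lambda>s. (1 - s / t) * 1) = (\<lambda>s. (- 1 / t) * 1 + (1 + t - s) / t)"
    using t by (simp add: fun_eq_iff field_simps)
  also have "jackson 0 t \<dots> = (- 1 / t) * jackson 0 t (\<lambda>_. 1) + jackson 0 t (\<lambda>s. (1 + t - s) / t)"
    by (intro jackson_linear adm one bounded_on_grid_continuous continuous_intros) (use t in auto)
  finally show ?thesis
    by (simp add: jackson_zero_telescoping[OF adm])
qed

text \<open>
  Passing from \<open>u / q ^ N\<close> to \<open>u / q ^ (N + 1)\<close> multiplies the product by \<open>1 - u / q ^ (N + 1)\<close>, whose
  modulus is eventually larger than \<open>1\<close>. Hence, up to a constant, the product starting at
  \<open>u / q ^ N\<close> dominates all products that start further along the same progression.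
\<close>

lemma qpoch_inf_expanding_bound:
  assumes u: "u \<noteq> 0" and nz: "\<And>N. qpoch_inf (u / q ^ N) q \<noteq> 0"
  shows "\<exists>C>0. \<exists>N0. \<forall>N\<ge>N0. \<forall>n. 
    norm (qpoch_inf (u / q ^ N * q ^ n) q) \<le> C * norm (qpoch_inf (u / q ^ N) q)"
proof -
  define b where "b N = norm (qpoch_inf (u / q ^ N) q)" for N
  have b: "b N > 0" for N using nz by (simp add: b_def)
  have "(\<lambda>N. q ^ N / (q ^ N - u)) \<longlonglongrightarrow> 0 / (0 - u)"
    using u q_lt_1 by (intro tendsto_intros LIMSEQ_power_zero) auto
  then have "eventually (\<lambda>N. norm (q ^ N / (q ^ N - u)) < 1) sequentially"
    using tendsto_norm_zero by (intro order_tendstoD(2)[of _ 0]) fastforce+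
  then obtain N0 where N0: "\<And>N. N \<ge> N0 \<Longrightarrow> norm (q ^ N / (q ^ N - u)) < 1"
    by (auto simp: eventually_sequentially)
  define C where "C = max 1 (qpoch_bound (norm (u / q ^ N0)) / b N0)"
  have C: "C \<ge> 1" by (simp add: C_def)
  have "norm (qpoch_inf (u / q ^ N * q ^ n) q) \<le> C * b N" if "N \<ge> N0" for N n
    using that
  proof (induction N arbitrary: n rule: nat_induct_at_least)
    case base
    have "norm (u / q ^ N0 * q ^ n) \<le> norm (u / q ^ N0)"
      by (rule norm_mult_q_power_le)
    then have "norm (qpoch_inf (u / q ^ N0 * q ^ n) q) \<le> qpoch_bound (norm (u / q ^ N0))"
      by (rule norm_qpoch_inf_le)
    also have "\<dots> = qpoch_bound (norm (u / q ^ N0)) / b N0 * b N0"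
      using b[of N0] by simp
    also have "\<dots> \<le> C * b N0"
      unfolding C_def using b[of N0] by (intro mult_right_mono) auto
    finally show ?case .
  next
    case (Suc N)
    show ?case
    proof (cases n)
      case 0
      then show ?thesis
        using C b[of "Suc N"] by (simp add: b_def)
    next
      case (Suc m)
      have nz': "1 - u / q ^ Suc N \<noteq> 0"
        using nz[of "Suc N"] qpoch_inf_rec[of "u / q ^ Suc N"] by auto
      have "norm (q ^ Suc N / (q ^ Suc N - u)) < 1"
        using Suc.hyps by (intro N0) simp
      also have "q ^ Suc N / (q ^ Suc N - u) = 1 / (1 - u / q ^ Suc N)"
        by (simp add: field_simps)
      finally have "1 \<le> norm (1 - u / q ^ Suc N)"
        using nz' by (simp add: norm_divide field_simps)
      moreover have "b (Suc N) = norm (1 - u / q ^ Suc N) * b N"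
        using qpoch_inf_rec[of "u / q ^ Suc N"] by (simp add: b_def norm_mult)
      ultimately have "b N \<le> b (Suc N)"
        using b[of N] by simp
      moreover have "norm (qpoch_inf (u / q ^ Suc N * q ^ n) q) \<le> C * b N"
        using Suc.IH[of m] Suc by simp
      ultimately show ?thesis
        using C by (smt (verit) mult_left_mono)
    qed
  qed
  moreover have "C > 0" using C by simp
  ultimately show ?thesis unfolding b_def by blast
qed

text \<open>
  Put \<open>u = q / t\<close> and \<open>b\<^sub>N = (u / q\<^sup>N)\<^sub>\<infinity>\<close>. In the sum over the nodes \<open>q\<^sup>n\<close> for lower end point
  \<open>t q\<^sup>N\<close>, the term \<open>n = 0\<close> is \<open>b\<^sub>N (q)\<^sub>\<infinity>\<close>, and all later terms are \<open>O(b\<^sub>N\<^sub>-\<^sub>1) = o(b\<^sub>N)\<close>. The sum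
  over the nodes \<open>t q\<^sup>N q\<^sup>n\<close> is \<open>O(q\<^sup>N)\<close>, while \<open>b\<^sub>N\<close> stays away from \<open>0\<close>.
\<close>

lemma jackson_zero_one_asymptotic:
  assumes adm: "admissible 0 t"
  shows "(\<lambda>N. jackson 0 (t * q ^ Suc N) (\<lambda>_. 1) / qpoch_inf (q / t / q ^ Suc N) q)
     \<longlonglongrightarrow> qpoch_inf q q"
proof -
  define u where "u = q / t"
  have t: "t \<noteq> 0" and u: "u \<noteq> 0" using adm by (auto simp: admissible_def u_def)
  note admN = admissible_zero_mult_q_power[OF adm]
  have one: "bounded_on_grid t (\<lambda>_. 1)" for t
    by (intro bounded_on_grid_continuous continuous_intros)
  have argN: "q / (t * q ^ N) = u / q ^ N" for N
    by (simp add: u_def)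
  define b where "b N = qpoch_inf (u / q ^ N) q" for N
  have b: "b N \<noteq> 0" for N
    using admN[of N] unfolding admissible_zero theta_def argN b_def by auto
  obtain C N0 where C: "C > 0"
    and bound: "\<And>N n. N \<ge> N0 \<Longrightarrow> norm (qpoch_inf (u / q ^ N * q ^ n) q) \<le> C * norm (b N)"
    using qpoch_inf_expanding_bound[OF u] b unfolding b_def by metis
  have u_inf: "qpoch_inf u q \<noteq> 0"
    using b[of 0] by (simp add: b_def)
  define G where "G = 1 / (1 - norm q)"
  have geo: "(\<lambda>n. norm q ^ n) sums G"
    unfolding G_def using q_lt_1 by (intro geometric_sums) auto
  define S where "S v N = suminf (endpoint_term 0 (t * q ^ N) v (\<lambda>_. 1))" for v N
  have J: "jackson 0 (t * q ^ N) (\<lambda>_. 1) = S 1 N - S (t * q ^ N) N" for N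
    unfolding S_def by (rule jackson_split(4)[OF admN one])
  note summ = jackson_split(1,2)[OF admN one]
  \<comment> \<open>The ratio \<open>b\<^sub>N / b\<^sub>N\<^sub>+\<^sub>1\<close> of consecutive products.\<close>
  define d where "d N = 1 / (1 - u / q ^ Suc N)" for N
  have d_lim: "d \<longlonglongrightarrow> 0"
  proof -
    have "(\<lambda>N. q ^ Suc N / (q ^ Suc N - u)) \<longlonglongrightarrow> 0 / (0 - u)"
      using u q_lt_1 by (intro tendsto_intros LIMSEQ_Suc[OF LIMSEQ_power_zero]) auto
    moreover have "q ^ Suc N / (q ^ Suc N - u) = d N" for N
      by (simp add: d_def field_simps)
    ultimately show ?thesis by simp
  qed
  have b_Suc: "b N = d N * b (Suc N)" for N
  proof -
    have "b (Suc N) = (1 - u / q ^ Suc N) * b N"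
      unfolding b_def by (subst qpoch_inf_rec) simp
    moreover from this have "1 - u / q ^ Suc N \<noteq> 0"
      using b[of "Suc N"] by auto
    ultimately show ?thesis by (simp add: d_def)
  qed
  have q_shift: "norm (q * q ^ n) \<le> 1" for n
    using norm_q_power_le_1[of "Suc n"] by (simp add: norm_mult norm_power)
  have lim1: "(\<lambda>N. S 1 (Suc N) / b (Suc N) - qpoch_inf q q) \<longlonglongrightarrow> 0"
  proof (rule Lim_null_comparison)
    show "(\<lambda>N. C * qpoch_bound 1 * G * norm (d N)) \<longlonglongrightarrow> 0"
      using tendsto_mult_right_zero[OF tendsto_norm_zero[OF d_lim]] .
    show "eventually (\<lambda>N. norm (S 1 (Suc N) / b (Suc N) - qpoch_inf q q)
        \<le> C * qpoch_bound 1 * G * norm (d N)) sequentially"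
    proof (intro eventually_sequentiallyI[of N0])
      fix N assume N: "N \<ge> N0"
      let ?e = "endpoint_term 0 (t * q ^ Suc N) 1 (\<lambda>_. 1)"
      have e: "?e n = q ^ n * (qpoch_inf (u / q ^ Suc N * q ^ n) q * qpoch_inf (q * q ^ n) q)" for n
      proof -
        have "q ^ n * q / (t * q ^ Suc N) = u / q ^ Suc N * q ^ n"
          by (simp add: u_def)
        then show ?thesis
          unfolding endpoint_term_def weight_def by (simp add: mult_ac)
      qed
      have "norm (?e (Suc n)) \<le> norm q ^ n * (C * norm (b N) * qpoch_bound 1)" for n
      proof -
        have "u / q ^ Suc N * q ^ Suc n = u / q ^ N * q ^ n"
          by simp
        then show ?thesis
          unfolding e norm_mult norm_power
          using bound[OF N, of n] norm_qpoch_inf_le[OF q_shift[of "Suc n"]] C q_lt_1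
          by (intro mult_mono mult_nonneg_nonneg power_decreasing) auto
      qed
      then have "norm (\<Sum>n. ?e (Suc n)) \<le> (\<Sum>n. norm q ^ n * (C * norm (b N) * qpoch_bound 1))"
        using geo by (intro norm_suminf_le summable_mult2) (auto simp: sums_iff)
      also have "\<dots> = G * (C * norm (b N) * qpoch_bound 1)"
        using sums_mult2[OF geo] by (simp add: sums_iff)
      also have "(\<Sum>n. ?e (Suc n)) = S 1 (Suc N) - b (Suc N) * qpoch_inf q q"
        using suminf_split_head[OF summ(1)[of "Suc N"]] e[of 0] by (simp only: S_def) (simp add: b_def)
      finally have "norm (S 1 (Suc N) - b (Suc N) * qpoch_inf q q) / norm (b (Suc N)) \<le>
          G * (C * norm (b N) * qpoch_bound 1) / norm (b (Suc N))"
        by (intro divide_right_mono) auto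
      also have "\<dots> = C * qpoch_bound 1 * G * norm (d N)"
        using b[of "Suc N"] b_Suc[of N] by (simp add: norm_mult)
      also have "norm (S 1 (Suc N) - b (Suc N) * qpoch_inf q q) / norm (b (Suc N)) =
          norm (S 1 (Suc N) / b (Suc N) - qpoch_inf q q)"
        using b[of "Suc N"] by (simp add: norm_divide [symmetric] diff_divide_distrib)
      finally show "norm (S 1 (Suc N) / b (Suc N) - qpoch_inf q q) \<le> C * qpoch_bound 1 * G * norm (d N)" .
    qed
  qed
  have lim2: "(\<lambda>N. S (t * q ^ Suc N) (Suc N) / b (Suc N)) \<longlonglongrightarrow> 0"
  proof (rule Lim_null_comparison)
    define K where "K = norm t * (qpoch_bound 1 * qpoch_bound (norm t)) * G * C / norm (qpoch_inf u q)"
    show "(\<lambda>N. K * norm q ^ Suc N) \<longlonglongrightarrow> 0"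
      using q_lt_1 by (intro tendsto_mult_right_zero LIMSEQ_Suc[OF LIMSEQ_power_zero]) auto
    show "eventually (\<lambda>N. norm (S (t * q ^ Suc N) (Suc N) / b (Suc N)) \<le> K * norm q ^ Suc N) sequentially"
    proof (intro eventually_sequentiallyI[of N0])
      fix N assume N: "N \<ge> N0"
      define T where "T = t * q ^ Suc N"
      let ?e = "endpoint_term 0 T T (\<lambda>_. 1)"
      have T: "T \<noteq> 0" using t by (simp add: T_def)
      have e: "?e n = T * q ^ n * (qpoch_inf (q * q ^ n) q * qpoch_inf (T * q ^ n * q) q)" for n
        using T by (simp add: endpoint_term_def weight_def mult.commute)
      have "norm (?e n) \<le> norm q ^ n * (norm T * (qpoch_bound 1 * qpoch_bound (norm t)))" for n
      proof -
        have arg: "T * q ^ n * q = t * q ^ (Suc N + n + 1)"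
          by (simp add: T_def power_add)
        have "norm (qpoch_inf (T * q ^ n * q) q) \<le> qpoch_bound (norm t)"
          unfolding arg by (intro norm_qpoch_inf_le norm_mult_q_power_le)
        then have "norm (?e n) \<le> norm T * norm q ^ n * (qpoch_bound 1 * qpoch_bound (norm t))"
          unfolding e norm_mult norm_power
          by (intro mult_mono norm_qpoch_inf_le[OF q_shift] mult_nonneg_nonneg)
             (auto intro: less_imp_le)
        then show ?thesis by (simp add: mult_ac)
      qed
      then have "norm (\<Sum>n. ?e n) \<le> (\<Sum>n. norm q ^ n * (norm T * (qpoch_bound 1 * qpoch_bound (norm t))))"
        using geo by (intro norm_suminf_le summable_mult2) (auto simp: sums_iff)
      also have "\<dots> = G * (norm T * (qpoch_bound 1 * qpoch_bound (norm t)))"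
        using sums_mult2[OF geo] by (simp add: sums_iff)
      finally have 1: "norm (S T (Suc N)) \<le> G * (norm T * (qpoch_bound 1 * qpoch_bound (norm t)))"
        by (simp add: S_def T_def)
      \<comment> \<open>The bound for \<open>n = N + 1\<close>, where the progression has reached \<open>u\<close>.\<close>
      have "norm (qpoch_inf u q) \<le> C * norm (b (Suc N))"
        using bound[of "Suc N" "Suc N"] N by simp
      then have 2: "1 / norm (b (Suc N)) \<le> C / norm (qpoch_inf u q)"
        using b[of "Suc N"] u_inf by (simp add: field_simps)
      have "norm (S T (Suc N)) * (1 / norm (b (Suc N))) \<le>
          G * (norm T * (qpoch_bound 1 * qpoch_bound (norm t))) * (C / norm (qpoch_inf u q))"
        using 1 2 by (intro mult_mono) (auto intro: order_trans[OF norm_ge_zero])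
      also have "\<dots> = K * norm q ^ Suc N"
        by (simp add: K_def T_def norm_mult norm_power)
      finally show "norm (S (t * q ^ Suc N) (Suc N) / b (Suc N)) \<le> K * norm q ^ Suc N"
        by (simp add: norm_divide T_def)
    qed
  qed
  have "(\<lambda>N. (S 1 (Suc N) / b (Suc N) - qpoch_inf q q) + qpoch_inf q q -
      S (t * q ^ Suc N) (Suc N) / b (Suc N)) \<longlonglongrightarrow> 0 + qpoch_inf q q - 0"
    by (intro tendsto_intros lim1 lim2)
  then show ?thesis
    unfolding J by (simp add: diff_divide_distrib b_def u_def)
qed

text \<open>
  An equivalent form of Jacobi's triple product identity. The ratio of the two sides is invariant
  under \<open>t \<mapsto> t * q\<close>, and it tends to \<open>1\<close> along \<open>t * q ^ N\<close>.
\<close>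

theorem jackson_zero_one:
  assumes adm: "admissible 0 t"
  shows "jackson 0 t (\<lambda>_. 1) = theta t"
proof -
  have t: "t \<noteq> 0" and th: "theta t \<noteq> 0" using adm by (auto simp: admissible_def)
  note admN = admissible_zero_mult_q_power[OF adm]
  \<comment> \<open>Quasi-periodicity of both functions, cross-multiplied.\<close>
  have ratio: "jackson 0 (t * q ^ N) (\<lambda>_. 1) * theta t = jackson 0 t (\<lambda>_. 1) * theta (t * q ^ N)" for N
  proof (induction N)
    case (Suc N)
    have arg: "t * q ^ Suc N = (t * q ^ N) * q" by simp
    have "t * q ^ N \<noteq> 0" using t by simp
    then show ?case
      using Suc unfolding arg theta_mult_q[OF \<open>t * q ^ N \<noteq> 0\<close>] jackson_zero_one_mult_q[OF admN]
      by (simp add: field_simps)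
  qed simp
  let ?b = "\<lambda>N. qpoch_inf (q / t / q ^ Suc N) q"
  have nz: "?b N \<noteq> 0" for N
    using admN[of "Suc N"] by (auto simp: admissible_zero theta_def)
  have "(\<lambda>N. jackson 0 (t * q ^ Suc N) (\<lambda>_. 1) / ?b N * theta t) \<longlonglongrightarrow> qpoch_inf q q * theta t"
    by (intro tendsto_intros jackson_zero_one_asymptotic adm)
  moreover have "jackson 0 (t * q ^ Suc N) (\<lambda>_. 1) / ?b N * theta t =
      jackson 0 t (\<lambda>_. 1) * (qpoch_inf q q * qpoch_inf (t * q * q ^ N) q)" for N
  proof -
    have "theta (t * q ^ Suc N) / ?b N = qpoch_inf q q * qpoch_inf (t * q * q ^ N) q"
      using nz[of N] by (simp add: theta_def mult_ac)
    then show ?thesis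
      using ratio[of "Suc N"]
      by (metis (no_types, lifting) times_divide_eq_left times_divide_eq_right)
  qed
  moreover have "(\<lambda>N. jackson 0 t (\<lambda>_. 1) * (qpoch_inf q q * qpoch_inf (t * q * q ^ N) q))
      \<longlonglongrightarrow> jackson 0 t (\<lambda>_. 1) * (qpoch_inf q q * qpoch_inf 0 q)"
    by (intro tendsto_intros tendsto_qpoch_inf q_power_tendsto_0)
  ultimately have "qpoch_inf q q * theta t = jackson 0 t (\<lambda>_. 1) * qpoch_inf q q"
    using LIMSEQ_unique by fastforce
  then show ?thesis by simp
qed

lemma transform_identity_zero_one:
  assumes "admissible 0 t"
  shows "transform_identity 0 t (\<lambda>_. 1)"
proof -
  have "delta_term 0 t (\<lambda>_. 1) = (\<lambda>n. if n = 0 then 1 else 0)"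
    by (auto simp: delta_term_def q_Delta_one fun_eq_iff power_0_left)
  then show ?thesis
    using assms sums_single[of 0 "\<lambda>_. 1 :: complex"]
    by (simp add: transform_identity_def jackson_zero_one admissible_def)
qed

text \<open>
  The moments are read off from the left side, which terminates for \<open>c = 0\<close> and \<open>f\<close> a monomial. Up
  to the factor \<open>\<theta>(t)\<close> they are the Rogers--Szego polynomials.
\<close>

lemma jackson_zero_power:
  assumes adm: "admissible 0 t"
  shows "jackson 0 t (\<lambda>s. s ^ N) = theta t * (\<Sum>n\<le>N. t ^ n / qpoch q q n * q_falling n N)"
proof -
  have "transform_identity 0 t (poly (monom 1 N))"
    by (rule transform_identity_poly[where P = "\<lambda>c. c = 0", OF _ _ refl adm])
       (auto intro: transform_identity_zero_one)
  then have "transform_identity 0 t (\<lambda>s. s ^ N)"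
    by (simp add: poly_monom[abs_def])
  then have "(\<lambda>n. t ^ n / qpoch q q n * q_falling n N) sums (jackson 0 t (\<lambda>s. s ^ N) / theta t)"
    by (simp add: transform_identity_def delta_term_def[abs_def] q_Delta_zero_power)
  moreover have "(\<lambda>n. t ^ n / qpoch q q n * q_falling n N) sums
      (\<Sum>n\<le>N. t ^ n / qpoch q q n * q_falling n N)"
    by (rule sums_finite) (auto simp: q_falling_def)
  ultimately have "jackson 0 t (\<lambda>s. s ^ N) / theta t = (\<Sum>n\<le>N. t ^ n / qpoch q q n * q_falling n N)"
    by (rule sums_unique2)
  then show ?thesis
    using adm by (simp add: admissible_def field_simps)
qed

section \<open>The constant function for general c\<close>

lemma jackson_scale:
  assumes "admissible c t" "bounded_on_grid t f"
  shows "jackson c t (\<lambda>s. a * f s) = a * jackson c t f"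
proof -
  have "jackson c t (\<lambda>s. a * f s + 0) = a * jackson c t f + jackson c t (\<lambda>_. 0)"
    by (intro jackson_linear assms bounded_on_grid_continuous continuous_intros)
  then show ?thesis
    by (simp add: jackson_def q_integral_def q_integral_term_def)
qed

text \<open>
  The product vanishes at the first \<open>N\<close> nodes of the progression that starts at \<open>t\<close>. For \<open>s \<noteq> 0\<close> the function equals
  \<open>(t/s)\<^sub>N s\<^sup>2\<^sup>N\<close>, which is how it enters the q-binomial series of \<open>(cts)\<^sub>\<infinity> / (cs\<^sup>2)\<^sub>\<infinity>\<close>.
\<close>

definition node_basis :: "complex \<Rightarrow> nat \<Rightarrow> complex \<Rightarrow> complex" where
  "node_basis t N s = (\<Prod>j<N. s - t * q ^ j) * s ^ N"

text \<open>
  The \<open>N\<close>-fold iteration of the shift \<open>t \<mapsto> t * q\<close>; the constants are absorbed by the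
  quasi-periodicity of \<open>\<theta>\<close>.
\<close>

lemma jackson_zero_prod:
  assumes "admissible 0 t" "bounded_on_grid t p"
  shows "jackson 0 t (\<lambda>s. (\<Prod>j<N. s - t * q ^ j) * p s) / theta t =
    jackson 0 (t * q ^ N) p / theta (t * q ^ N)"
  using assms
proof (induction N arbitrary: t)
  case (Suc N)
  define P where "P s = (\<Prod>j<N. s - t * q * q ^ j) * p s" for s
  have t: "t \<noteq> 0" and th: "theta t \<noteq> 0" using Suc.prems by (auto simp: admissible_def)
  have P: "bounded_on_grid t P"
    unfolding P_def
    by (intro bounded_on_grid_mult Suc.prems bounded_on_grid_continuous continuous_intros)
  have PP: "bounded_on_grid t (\<lambda>s. (1 - s / t) * P s)"
    by (intro bounded_on_grid_mult P bounded_on_grid_continuous continuous_intros) (use t in auto)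
  have "(\<lambda>s. (\<Prod>j<Suc N. s - t * q ^ j) * p s) = (\<lambda>s. - t * ((1 - s / t) * P s))"
  proof
    fix s
    have "(\<Prod>j<Suc N. s - t * q ^ j) = (s - t) * (\<Prod>j<N. s - t * q * q ^ j)"
      by (subst prod.lessThan_Suc_shift) (simp add: mult_ac)
    also have "s - t = - t * (1 - s / t)"
      using t by (simp add: field_simps)
    finally show "(\<Prod>j<Suc N. s - t * q ^ j) * p s = - t * ((1 - s / t) * P s)"
      by (simp only: P_def mult.assoc)
  qed
  then have "jackson 0 t (\<lambda>s. (\<Prod>j<Suc N. s - t * q ^ j) * p s) = - t * jackson 0 (t * q) P"
    by (simp only: jackson_scale[OF Suc.prems(1) PP] jackson_zero_mult_q[OF Suc.prems(1) P])
  then have "jackson 0 t (\<lambda>s. (\<Prod>j<Suc N. s - t * q ^ j) * p s) / theta t =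
      jackson 0 (t * q) P / theta (t * q)"
    using t th by (simp add: theta_mult_q[OF t])
  also have "\<dots> = jackson 0 (t * q * q ^ N) p / theta (t * q * q ^ N)"
    unfolding P_def
    by (intro Suc.IH admissible_zero_mult_q bounded_on_grid_mult_q Suc.prems)
  finally show ?case by (simp add: mult_ac)
qed simp

lemma jackson_zero_basis:
  assumes "admissible 0 t"
  shows "jackson 0 t (node_basis t N) = 
    theta t * (\<Sum>j\<le>N. (t * q ^ N) ^ j / qpoch q q j * q_falling j N)"
proof -
  have th: "theta t \<noteq> 0" using assms by (simp add: admissible_def)
  note adm = admissible_zero_mult_q_power[OF assms, of N]
  have th': "theta (t * q ^ N) \<noteq> 0" using adm by (simp add: admissible_def)
  have "jackson 0 t (node_basis t N) / theta t = jackson 0 (t * q ^ N) (\<lambda>s. s ^ N) / theta (t * q ^ N)"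
    unfolding node_basis_def[abs_def]
    by (intro jackson_zero_prod assms bounded_on_grid_continuous continuous_intros)
  also have "\<dots> = (\<Sum>j\<le>N. (t * q ^ N) ^ j / qpoch q q j * q_falling j N)"
    using th' by (simp add: jackson_zero_power[OF adm])
  finally show ?thesis using th by (simp add: field_simps)
qed

lemma bounded_on_grid_basis: "bounded_on_grid t (node_basis t N)"
  unfolding node_basis_def[abs_def] by (intro bounded_on_grid_continuous continuous_intros)

lemma basis_sums:
  assumes "s \<noteq> 0" "norm (c * s\<^sup>2) < 1"
  shows "(\<lambda>N. c ^ N / qpoch q q N * node_basis t N s) sums
    (qpoch_inf (c * t * s) q / qpoch_inf (c * s\<^sup>2) q)"
proof -
  have *: "qpoch (t / s) q N * s ^ N = (\<Prod>j<N. s - t * q ^ j)" for N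
    using assms(1) by (induction N) (simp_all add: qpoch_Suc field_simps)
  have "t / s * (c * s\<^sup>2) = c * t * s"
    using assms(1) by (simp add: power2_eq_square)
  moreover have "qpoch (t / s) q N / qpoch q q N * (c * s\<^sup>2) ^ N = c ^ N / qpoch q q N * node_basis t N s" for N
    by (simp add: node_basis_def *[symmetric] power_mult_distrib power2_eq_square)
  ultimately show ?thesis
    using q_binomial[OF assms(2), of "t / s"] by simp
qed

lemma norm_basis_one_le: "norm (node_basis t N (q ^ n)) \<le> qpoch_bound (norm t)"
proof -
  have "norm (node_basis t N (q ^ n)) \<le> (\<Prod>j<N. norm (q ^ n - t * q ^ j)) * 1"
    unfolding node_basis_def norm_mult prod_norm[symmetric]
    using norm_q_power_le_1[of "n * N"]
    by (intro mult_left_mono prod_nonneg) (auto simp: norm_power power_mult)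
  also have "(\<Prod>j<N. norm (q ^ n - t * q ^ j)) \<le> (\<Prod>j<N. 1 + norm t * norm q ^ j)"
  proof (intro prod_mono conjI)
    show "norm (q ^ n - t * q ^ j) \<le> 1 + norm t * norm q ^ j" for j
      using norm_triangle_ineq4[of "q ^ n" "t * q ^ j"] norm_q_power_le_1[of n]
      by (simp add: norm_mult norm_power)
  qed auto
  also have "\<dots> \<le> qpoch_bound (norm t)"
    by (intro prod_one_plus_le) auto
  finally show ?thesis by simp
qed

lemma norm_basis_t_le: "norm (node_basis t N (t * q ^ n)) \<le> (norm t)\<^sup>2 ^ N * qpoch_bound 1"
proof -
  have "norm ((\<Prod>j<N. t * q ^ n - t * q ^ j)) \<le> norm t ^ N * (\<Prod>j<N. 1 + 1 * norm q ^ j)"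
  proof -
    have "norm (\<Prod>j<N. t * q ^ n - t * q ^ j) = (\<Prod>j<N. norm t * norm (q ^ n - q ^ j))"
      by (simp only: prod_norm[symmetric] right_diff_distrib[symmetric] norm_mult)
    also have "\<dots> = norm t ^ N * (\<Prod>j<N. norm (q ^ n - q ^ j))"
      by (simp add: prod.distrib)
    also have "(\<Prod>j<N. norm (q ^ n - q ^ j)) \<le> (\<Prod>j<N. 1 + 1 * norm q ^ j)"
    proof (intro prod_mono conjI)
      show "norm (q ^ n - q ^ j) \<le> 1 + 1 * norm q ^ j" for j
        using norm_triangle_ineq4[of "q ^ n" "q ^ j"] norm_q_power_le_1[of n]
        by (simp add: norm_power)
    qed auto
    finally show ?thesis by (simp add: mult_left_mono)
  qed
  also have "(\<Prod>j<N. 1 + 1 * norm q ^ j) \<le> qpoch_bound 1"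
    by (intro prod_one_plus_le) auto
  finally have 1: "norm ((\<Prod>j<N. t * q ^ n - t * q ^ j)) \<le> norm t ^ N * qpoch_bound 1"
    by (simp add: mult_left_mono)
  have "norm ((t * q ^ n) ^ N) \<le> norm t ^ N"
    unfolding norm_power by (intro power_mono norm_mult_q_power_le) auto
  then have "norm (node_basis t N (t * q ^ n)) \<le> (norm t ^ N * qpoch_bound 1) * norm t ^ N"
    unfolding node_basis_def norm_mult using 1 order_trans[OF norm_ge_zero 1] by (intro mult_mono) auto
  then show ?thesis
    by (simp add: power2_eq_square power_mult_distrib mult_ac)
qed

text \<open>
  The smallness condition ensures that \<open>\<bar>c s\<^sup>2\<bar> < 1\<close> at every node \<open>s\<close>, as the q-binomial theorem
  requires.
\<close>

lemma small_c_bounds: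
  fixes c t :: complex
  assumes "norm c * (1 + (norm t)\<^sup>2) < 1"
  shows "norm c < 1" "norm (c * t\<^sup>2) < 1"
proof -
  have "norm c + norm c * (norm t)\<^sup>2 < 1"
    using assms by (simp add: distrib_left)
  moreover have "norm c * (norm t)\<^sup>2 \<ge> 0" by simp
  ultimately show "norm c < 1" "norm (c * t\<^sup>2) < 1"
    using norm_ge_zero[of c] unfolding norm_mult norm_power by linarith+
qed

text \<open>
  At the nodes \<open>q\<^sup>n\<close> the basis functions are bounded, at the nodes \<open>t q\<^sup>n\<close> they are \<open>O(\<bar>t\<bar>\<^sup>2\<^sup>N)\<close>. With
  the coefficient \<open>c\<^sup>N\<close> both are \<open>O(\<kappa>\<^sup>N)\<close> for \<open>\<kappa> = \<bar>c\<bar> (1 + \<bar>t\<bar>\<^sup>2) < 1\<close>, so the series may be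
  integrated term by term.
\<close>

lemma jackson_one_expansion:
  assumes t: "t \<noteq> 0" and th: "theta t \<noteq> 0" and small: "norm c * (1 + (norm t)\<^sup>2) < 1"
  shows "(\<lambda>N. c ^ N / qpoch q q N * jackson 0 t (node_basis t N)) sums jackson c t (\<lambda>_. 1)"
proof -
  define \<kappa> where "\<kappa> = norm c * (1 + (norm t)\<^sup>2)"
  have \<kappa>: "0 \<le> \<kappa>" "\<kappa> < 1" using small by (auto simp: \<kappa>_def)
  note sm = small_c_bounds[OF small]
  have adm: "admissible 0 t" using t th by (simp add: admissible_zero)
  define F where "F s = qpoch_inf (c * t * s) q / qpoch_inf (c * s\<^sup>2) q" for s
  define x where "x n N = c ^ N / qpoch q q N *
    q_integral_term q t 1 (\<lambda>s. weight 0 t s * node_basis t N s) n" for n N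
  obtain K1 where K1: "\<And>n. norm (weight 0 t (1 * q ^ n)) \<le> K1" "K1 > 0"
    using weight_bounded[of 0 1 t] by auto
  obtain K2 where K2: "\<And>n. norm (weight 0 t (t * q ^ n)) \<le> K2" "K2 > 0"
    using weight_bounded[of 0 t t] by auto
  define L where "L = K1 * qpoch_bound (norm t) + norm t * (K2 * qpoch_bound 1)"
  have bound: "norm (x n N) \<le> norm q ^ n * (inv_bound * (\<kappa> ^ N * L))" for n N
  proof -
    have c1: "norm c ^ N \<le> \<kappa> ^ N" and c2: "norm c ^ N * (norm t)\<^sup>2 ^ N \<le> \<kappa> ^ N"
      unfolding \<kappa>_def power_mult_distrib[symmetric]
      by (intro power_mono mult_left_mono; simp add: distrib_left)+
    have "norm (c ^ N * (1 * q ^ n * (weight 0 t (1 * q ^ n) * node_basis t N (1 * q ^ n)))) \<le>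
        \<kappa> ^ N * (norm q ^ n * (K1 * qpoch_bound (norm t)))"
      unfolding norm_mult norm_power
      using K1 c1 \<kappa> norm_basis_one_le[of t N n] by (intro mult_mono) auto
    moreover have "norm (c ^ N * (t * q ^ n * (weight 0 t (t * q ^ n) * node_basis t N (t * q ^ n)))) \<le>
        \<kappa> ^ N * (norm q ^ n * (norm t * (K2 * qpoch_bound 1)))"
    proof -
      have "norm (c ^ N * (t * q ^ n * (weight 0 t (t * q ^ n) * node_basis t N (t * q ^ n)))) \<le>
          norm c ^ N * (norm t * norm q ^ n * (K2 * ((norm t)\<^sup>2 ^ N * qpoch_bound 1)))"
        unfolding norm_mult norm_power
        using K2 norm_basis_t_le[of t N n] by (intro mult_mono) auto
      also have "\<dots> = (norm c ^ N * (norm t)\<^sup>2 ^ N) * (norm q ^ n * (norm t * (K2 * qpoch_bound 1)))"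
        by (simp add: mult_ac)
      also have "\<dots> \<le> \<kappa> ^ N * (norm q ^ n * (norm t * (K2 * qpoch_bound 1)))"
        using c2 K2(2) by (intro mult_right_mono mult_nonneg_nonneg) (auto intro: less_imp_le)
      finally show ?thesis .
    qed
    ultimately have "norm (c ^ N * q_integral_term q t 1 (\<lambda>s. weight 0 t s * node_basis t N s) n) \<le>
        \<kappa> ^ N * (norm q ^ n * (K1 * qpoch_bound (norm t))) +
        \<kappa> ^ N * (norm q ^ n * (norm t * (K2 * qpoch_bound 1)))"
      unfolding q_integral_term_def right_diff_distrib
      by (intro order_trans[OF norm_triangle_ineq4] add_mono)
    also have "\<dots> = \<kappa> ^ N * (norm q ^ n * L)"
      by (simp add: L_def algebra_simps)
    finally have "norm (1 / qpoch q q N) *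
        norm (c ^ N * q_integral_term q t 1 (\<lambda>s. weight 0 t s * node_basis t N s) n) \<le>
        inv_bound * (\<kappa> ^ N * (norm q ^ n * L))"
      using inv_bound_pos by (intro mult_mono norm_inverse_qpoch_q_le) auto
    then show ?thesis
      by (simp add: x_def norm_mult norm_divide mult_ac)
  qed
  have sum\<kappa>: "summable (\<lambda>N. inv_bound * (\<kappa> ^ N * L))"
    using \<kappa> by (intro summable_mult summable_mult2 summable_geometric) auto
  note D = dominated_double_series[of x, OF bound summable_q_power sum\<kappa>]
  have rows: "(\<Sum>N. x n N) = q_integral_term q t 1 (\<lambda>s. weight c t s * 1) n" for n
  proof -
    have F1: "(\<lambda>N. c ^ N / qpoch q q N * node_basis t N (1 * q ^ n)) sums F (1 * q ^ n)"
      unfolding F_def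
    proof (rule basis_sums)
      have "norm (c * (1 * q ^ n)\<^sup>2) = norm (c * q ^ (2 * n))"
        by (simp add: norm_mult norm_power power_mult[symmetric] mult.commute)
      also have "\<dots> < 1"
        using norm_mult_q_power_le[of c "2 * n"] sm(1) by simp
      finally show "norm (c * (1 * q ^ n)\<^sup>2) < 1" .
    qed simp
    have F2: "(\<lambda>N. c ^ N / qpoch q q N * node_basis t N (t * q ^ n)) sums F (t * q ^ n)"
      unfolding F_def
    proof (rule basis_sums)
      have arg: "c * (t * q ^ n)\<^sup>2 = c * t\<^sup>2 * q ^ (2 * n)"
        by (simp add: power_mult_distrib power_mult[symmetric] mult.commute)
      show "norm (c * (t * q ^ n)\<^sup>2) < 1"
        unfolding arg using norm_mult_q_power_le sm(2) by (rule le_less_trans)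
    qed (use t in simp)
    have "(\<lambda>N. x n N) sums (1 * q ^ n * weight 0 t (1 * q ^ n) * F (1 * q ^ n) -
        t * q ^ n * weight 0 t (t * q ^ n) * F (t * q ^ n))"
      using sums_diff[OF sums_mult[OF F1, of "1 * q ^ n * weight 0 t (1 * q ^ n)"]
          sums_mult[OF F2, of "t * q ^ n * weight 0 t (t * q ^ n)"]]
      by (simp add: x_def[abs_def] q_integral_term_def right_diff_distrib mult_ac)
    moreover have "weight 0 t s * F s = weight c t s" for s
      by (simp add: weight_def F_def)
    ultimately show ?thesis
      by (simp add: sums_iff q_integral_term_def mult.assoc)
  qed
  have cols: "(\<Sum>n. x n N) = c ^ N / qpoch q q N * jackson 0 t (node_basis t N)" for N
    unfolding x_def jackson_def q_integral_def
    using jackson_split(3)[OF adm bounded_on_grid_basis]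
    by (intro suminf_mult) (simp add: q_integrable_def)
  have "jackson c t (\<lambda>_. 1) = (\<Sum>n. \<Sum>N. x n N)"
    unfolding rows jackson_def q_integral_def ..
  also have "\<dots> = (\<Sum>N. c ^ N / qpoch q q N * jackson 0 t (node_basis t N))"
    using D(4) unfolding cols by (simp add: sums_iff)
  finally show ?thesis
    using D(3) unfolding cols by (simp add: summable_sums)
qed

text \<open>
  Inserting the moments gives the double sum of \<open>c\<^sup>N (t q\<^sup>N)\<^sup>j / ((q)\<^sub>j (q)\<^sub>N\<^sub>-\<^sub>j)\<close> over \<open>j \<le> N\<close>. Summed
  over \<open>N\<close> first, with \<open>N = i + j\<close>, the inner series is Euler's expansion of \<open>1 / (c q\<^sup>j)\<^sub>\<infinity>\<close>, which
  equals \<open>(c)\<^sub>j / (c)\<^sub>\<infinity>\<close>.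
\<close>

lemma transform_identity_one_small:
  assumes t: "t \<noteq> 0" and th: "theta t \<noteq> 0" and small: "norm c * (1 + (norm t)\<^sup>2) < 1"
  shows "transform_identity c t (\<lambda>_. 1)"
proof -
  note sm = small_c_bounds[OF small]
  have adm: "admissible 0 t" using t th by (simp add: admissible_zero)
  have c_inf: "qpoch_inf c q \<noteq> 0" by (rule qpoch_inf_nonzero[OF sm(1)])
  \<comment> \<open>The summand for \<open>j \<le> N\<close>, extended by \<open>0\<close> to all pairs so that the order of summation can be exchanged.\<close>
  define y where "y N j = (if j \<le> N then 
      c ^ N * (t * q ^ N) ^ j * (1 / qpoch q q j) * (1 / qpoch q q (N - j)) else 0)" for N j
  have bound: "norm (y N j) \<le> norm c ^ N * (norm t ^ j * norm q ^ (j * j) * inv_bound * inv_bound)" for N j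
  proof (cases "j \<le> N")
    case True
    have "norm (y N j) = norm c ^ N * (norm t ^ j * norm q ^ (N * j) * 
        norm (1 / qpoch q q j) * norm (1 / qpoch q q (N - j)))"
      using True by (simp add: y_def norm_mult norm_power power_mult_distrib power_mult norm_divide)
    also have "\<dots> \<le> norm c ^ N * (norm t ^ j * norm q ^ (j * j) * inv_bound * inv_bound)"
      using True q_lt_1 inv_bound_pos norm_inverse_qpoch_q_le
      by (intro mult_left_mono mult_mono power_decreasing mult_nonneg_nonneg)
         (auto intro: less_imp_le)
    finally show ?thesis .
  next
    case False
    then show ?thesis
      using inv_bound_pos by (auto simp: y_def intro!: mult_nonneg_nonneg less_imp_le)
  qed
  have s1: "summable (\<lambda>N. norm c ^ N)"
    using sm(1) by (intro summable_geometric) auto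
  have s2: "summable (\<lambda>j. norm t ^ j * norm q ^ (j * j) * inv_bound * inv_bound)"
    by (intro summable_mult2 summable_gaussian) auto
  note D = dominated_double_series[of y, OF bound s1 s2]
  have rows: "(\<Sum>j. y N j) = c ^ N / qpoch q q N * jackson 0 t (node_basis t N) / theta t" for N
  proof -
    have "(\<Sum>j. y N j) = (\<Sum>j\<le>N. y N j)"
      by (rule suminf_finite) (auto simp: y_def)
    also have "\<dots> = (\<Sum>j\<le>N. c ^ N / qpoch q q N * ((t * q ^ N) ^ j / qpoch q q j * q_falling j N))"
      by (intro sum.cong refl) (simp add: y_def q_falling_def)
    finally show ?thesis
      unfolding jackson_zero_basis[OF adm] sum_distrib_left[symmetric] using th by simp
  qed
  have cols: "(\<Sum>N. y N j) = delta_term c t (\<lambda>_. 1) j / qpoch_inf c q" for j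
  proof -
    have "(\<Sum>N. y N j) = (\<Sum>i. y (i + j) j) + (\<Sum>N<j. y N j)"
      by (rule suminf_split_initial_segment[OF D(2)])
    also have "(\<Sum>N<j. y N j) = 0"
      by (intro sum.neutral) (auto simp: y_def)
    also have "(\<lambda>i. y (i + j) j) = (\<lambda>i. (t ^ j * (c * q ^ j) ^ j / qpoch q q j) *
        (qpoch 0 q i / qpoch q q i * (c * q ^ j) ^ i))"
      by (simp add: y_def fun_eq_iff power_add power_mult_distrib power_mult[symmetric] mult_ac)
    also have "suminf \<dots> = (t ^ j * (c * q ^ j) ^ j / qpoch q q j) * (1 / qpoch_inf (c * q ^ j) q)"
    proof -
      have "norm (c * q ^ j) < 1"
        using norm_mult_q_power_le[of c j] sm(1) by simp
      from sums_mult[OF q_binomial[OF this, of 0], of "t ^ j * (c * q ^ j) ^ j / qpoch q q j"]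
      show ?thesis by (simp only: sums_iff) simp
    qed
    also have "qpoch_inf (c * q ^ j) q = qpoch_inf c q / qpoch c q j"
      by (rule qpoch_inf_shift[OF qpoch_nonzero[OF c_inf]])
    finally show ?thesis
      by (simp add: delta_term_def q_Delta_one mult_ac)
  qed
  have "(\<lambda>N. c ^ N / qpoch q q N * jackson 0 t (node_basis t N) / theta t) sums (jackson c t (\<lambda>_. 1) / theta t)"
    by (intro sums_divide jackson_one_expansion t th small)
  with D(4) have "(\<Sum>j. delta_term c t (\<lambda>_. 1) j / qpoch_inf c q) = jackson c t (\<lambda>_. 1) / theta t"
    unfolding rows cols by (rule sums_unique2)
  with D(3) have "(\<lambda>j. delta_term c t (\<lambda>_. 1) j / qpoch_inf c q) sums (jackson c t (\<lambda>_. 1) / theta t)"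
    unfolding cols by (simp add: sums_iff)
  from sums_mult[OF this, of "qpoch_inf c q"] show ?thesis
    using c_inf by (simp add: transform_identity_def)
qed

lemma norm_delta_term_one_le:
  assumes "norm c \<le> \<rho>"
  shows "norm (delta_term c t (\<lambda>_. 1) j) \<le>
    qpoch_bound \<rho> * inv_bound * ((norm t * \<rho>) ^ j * norm q ^ (j * j))"
proof -
  have "norm (delta_term c t (\<lambda>_. 1) j) = norm (qpoch c q j) * norm (1 / qpoch q q j) *
      ((norm t * norm c) ^ j * norm q ^ (j * j))"
    by (simp add: delta_term_def q_Delta_one norm_mult norm_divide norm_power power_mult_distrib power_mult)
  also have "\<dots> \<le> qpoch_bound \<rho> * inv_bound * ((norm t * \<rho>) ^ j * norm q ^ (j * j))"
    using assms inv_bound_pos order_trans[OF norm_ge_zero assms]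
    by (intro mult_mono norm_qpoch_le norm_inverse_qpoch_q_le power_mono mult_nonneg_nonneg
          mult_left_mono zero_le_power)
       (auto intro: less_imp_le)
  finally show ?thesis .
qed

text \<open>
  Analytic continuation in \<open>c\<close>. Multiplying by \<open>(c t\<^sup>2)\<^sub>\<infinity>\<close> clears the denominators
  \<open>(c t\<^sup>2 q\<^sup>2\<^sup>n)\<^sub>\<infinity>\<close>, and the factor \<open>(c)\<^sub>\<infinity>\<close> of the right side clears \<open>(c q\<^sup>2\<^sup>n)\<^sub>\<infinity>\<close>. The two
  resulting functions \<open>E\<close> and \<open>\<Sum>n. H n\<close> are holomorphic on discs of every radius \<open>\<rho>\<close>.
\<close>

theorem transform_identity_one:
  assumes adm: "admissible c t"
  shows "transform_identity c t (\<lambda>_. 1)"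
proof -
  have t: "t \<noteq> 0" and th: "theta t \<noteq> 0" using adm by (auto simp: admissible_def)
  define \<rho> where "\<rho> = norm c + 1"
  \<comment> \<open>A common bound for the bases \<open>x\<close>, \<open>x t\<close> and \<open>x t\<^sup>2\<close> with \<open>x\<close> in the disc of radius \<open>\<rho>\<close>.\<close>
  define \<sigma> where "\<sigma> = \<rho> * (1 + norm t + (norm t)\<^sup>2)"
  define \<delta> where "\<delta> = 1 / (1 + (norm t)\<^sup>2)"
  have den: "1 + (norm t)\<^sup>2 \<ge> 1" by simp
  have \<rho>: "\<rho> \<ge> 1" by (simp add: \<rho>_def)
  have \<delta>: "\<delta> > 0" "\<delta> \<le> \<rho>"
  proof -
    show "\<delta> > 0" using den unfolding \<delta>_def by (intro divide_pos_pos) linarith+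
    have "\<delta> \<le> 1" unfolding \<delta>_def using den by (subst divide_le_eq_1_pos) linarith+
    then show "\<delta> \<le> \<rho>" using \<rho> by simp
  qed
  have bd: "norm x \<le> \<sigma>" "norm (x * t) \<le> \<sigma>" "norm (x * t\<^sup>2) \<le> \<sigma>" if x: "norm x < \<rho>" for x
  proof -
    have "norm x * 1 \<le> \<sigma>" "norm x * norm t \<le> \<sigma>" "norm x * (norm t)\<^sup>2 \<le> \<sigma>"
      unfolding \<sigma>_def using x \<rho> by (intro mult_mono; simp)+
    then show "norm x \<le> \<sigma>" "norm (x * t) \<le> \<sigma>" "norm (x * t\<^sup>2) \<le> \<sigma>"
      by (simp_all add: norm_mult norm_power)
  qed
  define E where "E x = qpoch_inf (x * t\<^sup>2) q * theta t * (\<Sum>j. delta_term x t (\<lambda>_. 1) j)" for x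
  define H where "H n x = qpoch_inf (x * t\<^sup>2) q * (qpoch x q (2 * n) * (q ^ n * 
      (weight 0 t (q ^ n) * qpoch_inf (x * t * q ^ n) q))) -
    qpoch_inf x q * (qpoch (x * t\<^sup>2) q (2 * n) * (t * q ^ n *
      (weight 0 t (t * q ^ n) * qpoch_inf (x * t * (t * q ^ n)) q)))" for n x
  have delta_sum: "summable (delta_term x t (\<lambda>_. 1))" for x
    by (rule summable_comparison_test'[where N = 0, OF _ norm_delta_term_one_le[OF order_refl]])
       (intro summable_mult summable_gaussian, simp)
  have E_hol: "E holomorphic_on ball 0 \<rho>"
  proof -
    have "(\<lambda>x. \<Sum>j. delta_term x t (\<lambda>_. 1) j) holomorphic_on ball 0 \<rho>"
    proof (rule holomorphic_suminf)
      show "(\<lambda>x. delta_term x t (\<lambda>_. 1) j) holomorphic_on ball 0 \<rho>" for j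
        unfolding delta_term_def q_Delta_one qpoch_def[of _ q j, abs_def]
        by (intro holomorphic_intros) (simp add: qpoch_def[symmetric])
      show "norm (delta_term x t (\<lambda>_. 1) j) \<le> 
          qpoch_bound \<rho> * inv_bound * ((norm t * \<rho>) ^ j * norm q ^ (j * j))"
        if "x \<in> ball 0 \<rho>" for x j
        using that by (intro norm_delta_term_one_le) auto
      show "summable (\<lambda>j. qpoch_bound \<rho> * inv_bound * ((norm t * \<rho>) ^ j * norm q ^ (j * j)))"
        using \<rho> by (intro summable_mult summable_gaussian) auto
    qed auto
    then show ?thesis
      unfolding E_def[abs_def] by (intro holomorphic_intros)
  qed
  obtain K1 where K1: "\<And>n. norm (weight 0 t (1 * q ^ n)) \<le> K1" "K1 > 0"
    using weight_bounded[of 0 1 t] by auto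
  obtain K2 where K2: "\<And>n. norm (weight 0 t (t * q ^ n)) \<le> K2" "K2 > 0"
    using weight_bounded[of 0 t t] by auto
  define B where "B = qpoch_bound \<sigma>"
  have B: "B > 0" by (simp add: B_def)
  have H_hol: "(\<lambda>x. \<Sum>n. H n x) holomorphic_on ball 0 \<rho>"
  proof (rule holomorphic_suminf)
    show "H n holomorphic_on ball 0 \<rho>" for n
      unfolding H_def[abs_def] qpoch_def by (intro holomorphic_intros)
    show "summable (\<lambda>n. norm q ^ n * (B * (B * (K1 * B)) + B * (B * (norm t * (K2 * B)))))"
      by (intro summable_mult2 summable_q_power)
    show "norm (H n x) \<le> norm q ^ n * (B * (B * (K1 * B)) + B * (B * (norm t * (K2 * B))))"
      if "x \<in> ball 0 \<rho>" for x n
    proof -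
      have x: "norm x < \<rho>" using that by simp
      have b1: "norm (qpoch_inf x q) \<le> B" "norm (qpoch_inf (x * t\<^sup>2) q) \<le> B"
        "norm (qpoch x q m) \<le> B" "norm (qpoch (x * t\<^sup>2) q m) \<le> B" for m
        unfolding B_def using bd[OF x] by (auto intro: norm_qpoch_inf_le norm_qpoch_le)
      have b2: "norm (qpoch_inf (x * t * q ^ n) q) \<le> B"
        unfolding B_def using bd(2)[OF x] norm_mult_q_power_le order_trans
        by (intro norm_qpoch_inf_le) blast
      have b3: "norm (qpoch_inf (x * t * (t * q ^ n)) q) \<le> B"
        unfolding B_def using bd(3)[OF x] norm_mult_q_power_le[of "x * t\<^sup>2" n]
        by (intro norm_qpoch_inf_le) (simp add: power2_eq_square mult_ac)
      have "norm (qpoch_inf (x * t\<^sup>2) q * (qpoch x q (2 * n) * (q ^ n * 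
          (weight 0 t (q ^ n) * qpoch_inf (x * t * q ^ n) q)))) \<le> B * (B * (norm q ^ n * (K1 * B)))"
        unfolding norm_mult norm_power using b1 b2 K1 B
        by (intro mult_mono mult_nonneg_nonneg) (auto intro: less_imp_le)
      moreover have "norm (qpoch_inf x q * (qpoch (x * t\<^sup>2) q (2 * n) * (t * q ^ n *
          (weight 0 t (t * q ^ n) * qpoch_inf (x * t * (t * q ^ n)) q)))) \<le>
          B * (B * (norm t * norm q ^ n * (K2 * B)))"
        unfolding norm_mult[of "qpoch_inf x q"] norm_mult[of "qpoch (x * t\<^sup>2) q (2 * n)"]
          norm_mult[of "t * q ^ n"] norm_mult[of t "q ^ n"] 
          norm_mult[of "weight 0 t (t * q ^ n)"] norm_power using b1 b3 K2 B
        by (intro mult_mono mult_nonneg_nonneg) (auto intro: less_imp_le)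
      ultimately have "norm (H n x) \<le> B * (B * (norm q ^ n * (K1 * B))) +
          B * (B * (norm t * norm q ^ n * (K2 * B)))"
        unfolding H_def by (intro order_trans[OF norm_triangle_ineq4] add_mono)
      then show ?thesis by (simp add: algebra_simps)
    qed
  qed auto
  have H_eq: "(\<Sum>n. H n x) = qpoch_inf x q * qpoch_inf (x * t\<^sup>2) q * jackson x t (\<lambda>_. 1)"
    if x: "qpoch_inf x q \<noteq> 0" "qpoch_inf (x * t\<^sup>2) q \<noteq> 0" for x
  proof -
    have adm: "admissible x t" using t th x by (simp add: admissible_def)
    have w: "qpoch_inf (x * u\<^sup>2) q * weight x t (u * q ^ n) =
        qpoch (x * u\<^sup>2) q (2 * n) * (weight 0 t (u * q ^ n) * qpoch_inf (x * t * (u * q ^ n)) q)"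
      if "qpoch_inf (x * u\<^sup>2) q \<noteq> 0" for u n
    proof -
      have arg: "x * (u * q ^ n)\<^sup>2 = x * u\<^sup>2 * q ^ (2 * n)"
        by (simp add: power_mult_distrib power_mult[symmetric] mult.commute)
      show ?thesis
        unfolding weight_def arg qpoch_inf_shift[OF qpoch_nonzero[OF that]]
        using that by simp
    qed
    have "H n x = qpoch_inf x q * qpoch_inf (x * t\<^sup>2) q * 
        q_integral_term q t 1 (\<lambda>s. weight x t s * 1) n" for n
      using w[of 1 n] w[of t n] x
      by (simp add: H_def q_integral_term_def right_diff_distrib mult_ac)
    moreover have "bounded_on_grid t (\<lambda>_. 1)"
      by (intro bounded_on_grid_continuous continuous_intros)
    ultimately show ?thesis
      using jackson_split(3)[OF adm, of "\<lambda>_. 1"]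
      unfolding jackson_def q_integral_def q_integrable_def by (simp add: suminf_mult)
  qed
  have near_0: "E x = (\<Sum>n. H n x)" if "x \<in> ball 0 \<delta>" for x
  proof -
    have "norm x * (1 + (norm t)\<^sup>2) < 1"
      using that den by (simp add: \<delta>_def field_simps)
    then have id: "transform_identity x t (\<lambda>_. 1)" 
      and nz: "qpoch_inf x q \<noteq> 0" "qpoch_inf (x * t\<^sup>2) q \<noteq> 0"
      using small_c_bounds[of x t] qpoch_inf_nonzero transform_identity_one_small[OF t th] by auto
    have "(\<Sum>j. delta_term x t (\<lambda>_. 1) j) = qpoch_inf x q / theta t * jackson x t (\<lambda>_. 1)"
      using id by (simp add: transform_identity_def sums_iff)
    then show ?thesis
      unfolding H_eq[OF nz] E_def using th by simp
  qed
  have "E c = (\<Sum>n. H n c)"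
    by (rule analytic_continuation_open[of "ball 0 \<delta>" "ball 0 \<rho>" E "\<lambda>x. \<Sum>n. H n x"])
       (use \<delta> E_hol H_hol near_0 in \<open>auto simp: \<rho>_def\<close>)
  then have "theta t * (\<Sum>j. delta_term c t (\<lambda>_. 1) j) = qpoch_inf c q * jackson c t (\<lambda>_. 1)"
    using adm unfolding E_def by (subst (asm) H_eq) (auto simp: admissible_def)
  then have "(\<Sum>j. delta_term c t (\<lambda>_. 1) j) = qpoch_inf c q / theta t * jackson c t (\<lambda>_. 1)"
    using th by (simp add: field_simps)
  then show ?thesis
    unfolding transform_identity_def using summable_sums[OF delta_sum] by metis
qed

section \<open>From polynomials to holomorphic functions\<close>

text \<open>
  For \<open>b = c q\<^sup>n\<close> inside the unit disc, \<open>(b)\<^sub>k = (b)\<^sub>\<infinity> / (b q\<^sup>k)\<^sub>\<infinity>\<close> is a power series in \<open>q\<^sup>k\<close>. Thus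
  \<open>\<Delta>\<^sub>n\<close> for general \<open>c\<close> is \<open>\<Delta>\<^sub>n\<close> for \<open>c = 0\<close> applied to the product of \<open>s\<^sup>m\<close> with a power series
  in \<open>s\<close>.
\<close>

lemma q_Delta_power_sums:
  assumes "norm (c * q ^ n) < 1"
  shows "(\<lambda>i. qpoch_inf (c * q ^ n) q * ((c * q ^ n) ^ i / qpoch q q i * q_falling n (m + i)))
    sums q_Delta q c (\<lambda>s. s ^ m) n"
proof -
  define b where "b = c * q ^ n"
  define A where "A k = qpoch (inverse q ^ n) q k / qpoch q q k" for k
  have b: "norm b < 1" using assms by (simp add: b_def)
  have b_inf: "qpoch_inf b q \<noteq> 0" by (rule qpoch_inf_nonzero[OF b])
  have "(\<lambda>i. qpoch_inf b q * (qpoch 0 q i / qpoch q q i * (b * q ^ k) ^ i)) sums qpoch b q k" for k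
  proof -
    have "norm (b * q ^ k) < 1"
      using norm_mult_q_power_le b by (rule le_less_trans)
    from sums_mult[OF q_binomial[OF this, of 0], of "qpoch_inf b q"] show ?thesis
      unfolding qpoch_inf_shift[OF qpoch_nonzero[OF b_inf]] using b_inf by simp
  qed
  then have "(\<lambda>i. \<Sum>k\<le>n. A k * q ^ (k * Suc m) *
        (qpoch_inf b q * (qpoch 0 q i / qpoch q q i * (b * q ^ k) ^ i)))
      sums (\<Sum>k\<le>n. A k * q ^ (k * Suc m) * qpoch b q k)"
    by (intro sums_sum sums_mult)
  also have "(\<lambda>i. \<Sum>k\<le>n. A k * q ^ (k * Suc m) *
        (qpoch_inf b q * (qpoch 0 q i / qpoch q q i * (b * q ^ k) ^ i))) =
      (\<lambda>i. qpoch_inf b q * (b ^ i / qpoch q q i * q_falling n (m + i)))"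
  proof
    fix i
    have "q ^ (k * Suc m) * (q ^ k) ^ i = q ^ (k * Suc (m + i))" for k
      by (simp add: power_mult[symmetric] power_add[symmetric] algebra_simps)
    then have "A k * q ^ (k * Suc m) * (qpoch_inf b q * (qpoch 0 q i / qpoch q q i * (b * q ^ k) ^ i)) =
        qpoch_inf b q * (b ^ i / qpoch q q i * (A k * q ^ (k * Suc (m + i))))" for k
      by (simp add: power_mult_distrib)
    then show "(\<Sum>k\<le>n. A k * q ^ (k * Suc m) *
        (qpoch_inf b q * (qpoch 0 q i / qpoch q q i * (b * q ^ k) ^ i))) =
        qpoch_inf b q * (b ^ i / qpoch q q i * q_falling n (m + i))"
      unfolding sum_qpoch_inverse_q_power[symmetric] by (simp only: A_def sum_distrib_left)
  qed
  also have "(\<Sum>k\<le>n. A k * q ^ (k * Suc m) * qpoch b q k) = q_Delta q c (\<lambda>s. s ^ m) n"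
    unfolding q_Delta_def qpochs_def A_def b_def
    by (intro sum.cong refl) (simp add: power_add power_mult mult_ac)
  finally show ?thesis by (simp add: b_def)
qed

text \<open>
  In the expansion above only monomials of degree \<open>m + i \<ge> n\<close> contribute, and each contributes a
  bounded amount, at most a constant times \<open>r\<^sup>m\<^sup>+\<^sup>i / r\<^sup>n\<close>. The sum over \<open>i\<close> is geometric once
  \<open>\<bar>c q\<^sup>n\<bar> r < 1/2\<close>; the finitely many smaller \<open>n\<close> are covered by enlarging the constant.
\<close>

lemma norm_q_Delta_power_le:
  assumes r: "1 < r"
  shows "\<exists>K. \<forall>n m. norm (q_Delta q c (\<lambda>s. s ^ m) n) \<le> K * (r ^ m / r ^ n)"
proof -
  define L where "L = qpoch_bound 1 * (inv_bound * (qpoch_bound 1 * inv_bound)) * 2"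
  have L: "L > 0" using inv_bound_pos by (simp add: L_def)
  have "(\<lambda>n. norm (c * q ^ n) * r) \<longlonglongrightarrow> 0"
    by (intro tendsto_mult_left_zero tendsto_norm_zero q_power_tendsto_0)
  then have "eventually (\<lambda>n. norm (c * q ^ n) * r < 1 / 2) sequentially"
    by (intro order_tendstoD(2)[of _ 0]) auto
  then obtain N where N: "\<And>n. n \<ge> N \<Longrightarrow> norm (c * q ^ n) * r < 1 / 2"
    by (auto simp: eventually_sequentially)
  have large: "norm (q_Delta q c (\<lambda>s. s ^ m) n) \<le> L * (r ^ m / r ^ n)" if n: "n \<ge> N" for n m
  proof -
    define b where "b = norm (c * q ^ n)"
    have br: "b * r < 1 / 2" using N[OF n] by (simp add: b_def)
    have b0: "b \<ge> 0" by (simp add: b_def)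
    have "b * 1 \<le> b * r" using r b0 by (intro mult_left_mono) auto
    then have b1: "b < 1" using br by simp
    have fall: "norm (q_falling n (m + i)) \<le> qpoch_bound 1 * inv_bound * (r ^ m / r ^ n * r ^ i)" for i
    proof (cases "m + i < n")
      case False
      have "r ^ n \<le> r ^ (m + i)"
        using False r by (intro power_increasing) auto
      then have "1 \<le> r ^ m / r ^ n * r ^ i"
        using r by (simp add: power_add field_simps)
      then have "qpoch_bound 1 * inv_bound * 1 \<le> qpoch_bound 1 * inv_bound * (r ^ m / r ^ n * r ^ i)"
        using inv_bound_pos by (intro mult_left_mono) (auto intro: less_imp_le)
      then show ?thesis using norm_falling_le[of n "m + i"] by simp
    next
      case True
      then show ?thesis using r inv_bound_pos
        by (auto simp: q_falling_def intro!: mult_nonneg_nonneg less_imp_le)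
    qed
    let ?g = "\<lambda>i. qpoch_inf (c * q ^ n) q * ((c * q ^ n) ^ i / qpoch q q i * q_falling n (m + i))"
    have sums_g: "?g sums q_Delta q c (\<lambda>s. s ^ m) n"
      using b1 by (intro q_Delta_power_sums) (simp add: b_def)
    have "(\<lambda>i. (1 / 2 :: real) ^ i) sums 2"
      using geometric_sums[of "1 / 2 :: real"] by simp
    then have geo: "(\<lambda>i. L / 2 * (r ^ m / r ^ n) * (1 / 2) ^ i) sums (L / 2 * (r ^ m / r ^ n) * 2)"
      by (rule sums_mult)
    have le: "norm (?g i) \<le> L / 2 * (r ^ m / r ^ n) * (1 / 2) ^ i" for i
    proof -
      have "norm (?g i) = norm (qpoch_inf (c * q ^ n) q) * 
          (b ^ i * (norm (1 / qpoch q q i) * norm (q_falling n (m + i))))"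
        by (simp add: norm_mult norm_divide norm_power b_def)
      also have "\<dots> \<le> qpoch_bound 1 * (b ^ i * (inv_bound * 
          (qpoch_bound 1 * inv_bound * (r ^ m / r ^ n * r ^ i))))"
        using b1 b0 r inv_bound_pos
        by (intro mult_mono fall norm_inverse_qpoch_q_le norm_qpoch_inf_le mult_nonneg_nonneg)
           (auto simp: b_def intro: less_imp_le)
      also have "\<dots> = L / 2 * (r ^ m / r ^ n) * (b * r) ^ i"
        by (simp add: L_def power_mult_distrib)
      also have "\<dots> \<le> L / 2 * (r ^ m / r ^ n) * (1 / 2) ^ i"
        using br b0 r L by (intro mult_left_mono power_mono) auto
      finally show ?thesis .
    qed
    have "norm (\<Sum>i. ?g i) \<le> (\<Sum>i. L / 2 * (r ^ m / r ^ n) * (1 / 2) ^ i)"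
      using geo by (intro norm_suminf_le le) (auto simp: sums_iff)
    then show ?thesis
      using sums_g geo by (simp add: sums_iff)
  qed
  define D where "D n = (\<Sum>k\<le>n. norm (qpochs [inverse q ^ n, c * q ^ n] q k / qpoch q q k))" for n
  define K where "K = L + (\<Sum>n<N. D n) * r ^ N"
  have D: "D n \<ge> 0" for n by (simp add: D_def sum_nonneg)
  have "norm (q_Delta q c (\<lambda>s. s ^ m) n) \<le> K * (r ^ m / r ^ n)" for n m
  proof (cases "n \<ge> N")
    case True
    have "L * (r ^ m / r ^ n) \<le> K * (r ^ m / r ^ n)"
      unfolding K_def using r by (intro mult_right_mono) (auto intro!: mult_nonneg_nonneg sum_nonneg D)
    with large[OF True] show ?thesis by (rule order_trans)
  next
    case False
    have "norm (q_Delta q c (\<lambda>s. s ^ m) n) \<le>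
        (\<Sum>k\<le>n. norm (qpochs [inverse q ^ n, c * q ^ n] q k / qpoch q q k * (q ^ k) ^ m * q ^ k))"
      unfolding q_Delta_def by (rule norm_sum)
    also have "\<dots> \<le> D n"
      unfolding D_def
    proof (rule sum_mono)
      fix k
      have "norm ((q ^ k) ^ m * q ^ k) \<le> 1"
        using norm_q_power_le_1[of "k * m + k"] by (simp add: norm_mult norm_power power_add power_mult)
      then show "norm (qpochs [inverse q ^ n, c * q ^ n] q k / qpoch q q k * (q ^ k) ^ m * q ^ k) \<le>
          norm (qpochs [inverse q ^ n, c * q ^ n] q k / qpoch q q k)"
        unfolding mult.assoc norm_mult by (simp add: mult_left_le)
    qed
    also have "D n \<le> (\<Sum>n<N. D n)"
      using False by (intro member_le_sum) (auto intro: D)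
    also have "(\<Sum>n<N. D n) * 1 \<le> (\<Sum>n<N. D n) * (r ^ N * (r ^ m / r ^ n))"
    proof (rule mult_left_mono)
      have "r ^ n \<le> r ^ N * r ^ m"
        unfolding power_add[symmetric] using False r by (intro power_increasing) auto
      then show "1 \<le> r ^ N * (r ^ m / r ^ n)" using r by (simp add: field_simps)
    qed (auto intro: sum_nonneg D)
    also have "\<dots> \<le> K * (r ^ m / r ^ n)"
    proof -
      have "0 \<le> L * (r ^ m / r ^ n)" using L r by simp
      moreover have "K * (r ^ m / r ^ n) = L * (r ^ m / r ^ n) + (\<Sum>n<N. D n) * (r ^ N * (r ^ m / r ^ n))"
        by (simp add: K_def distrib_right add_divide_distrib mult.assoc)
      ultimately show ?thesis by linarith
    qed
    finally show ?thesis by simp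
  qed
  then show ?thesis by blast
qed

text \<open>
  A radius \<open>r\<close> strictly between \<open>max 1 \<bar>t\<bar>\<close> and \<open>R\<close> makes the Taylor series of \<open>f\<close> converge absolutely
  on the circle of radius \<open>r\<close>, which contains all nodes in its interior. Both sides are then double
  series (\<open>x\<close> for the left side, \<open>y\<close> for the right side) with product majorants, and the identity
  for monomials is summed up.
\<close>

theorem transform_identity_holomorphic:
  assumes adm: "admissible c t" and R: "1 < R" "norm t < R" and f: "f holomorphic_on ball 0 R"
  shows "transform_identity c t f"
proof -
  define r where "r = (max 1 (norm t) + R) / 2"
  have r: "1 < r" "norm t < r" "r < R" using R by (auto simp: r_def max_def)
  define a where "a m = (deriv ^^ m) f 0 / fact m" for m
  have f_sums: "(\<lambda>m. a m * w ^ m) sums f w" if "norm w < R" for w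
    using holomorphic_power_series[OF f, of w] that by (simp add: a_def)
  have sum_a: "summable (\<lambda>m. norm (a m) * r ^ m)"
  proof -
    \<comment> \<open>A point beyond the circle of radius \<open>r\<close>, where the series converges.\<close>
    define w where "w = complex_of_real ((r + R) / 2)"
    have w: "norm w = (r + R) / 2" unfolding w_def norm_of_real using r by auto
    have "summable (\<lambda>m. a m * w ^ m)"
      using f_sums[of w] w r by (simp add: sums_iff)
    then have "summable (\<lambda>m. norm (a m * complex_of_real r ^ m))"
      by (rule powser_insidea) (use w r in auto)
    then show ?thesis using r by (simp add: norm_mult norm_power)
  qed
  have power_bd: "bounded_on_grid t (\<lambda>s. s ^ m)" for m
    by (intro bounded_on_grid_continuous continuous_intros)
  have power_id: "transform_identity c t (\<lambda>s. s ^ m)" for m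
    using transform_identity_poly[of "\<lambda>_. True" c t "monom 1 m"] transform_identity_one adm
    by (simp add: poly_monom[abs_def])
  obtain K where K: "\<And>n m. norm (q_Delta q c (\<lambda>s. s ^ m) n) \<le> K * (r ^ m / r ^ n)"
    using norm_q_Delta_power_le[OF r(1)] by blast

  define x where "x n m = a m * delta_term c t (\<lambda>s. s ^ m) n" for n m
  have x_le: "norm (x n m) \<le>
      (qpoch_bound (norm c) * inv_bound * K * (norm t / r) ^ n) * (norm (a m) * r ^ m)" for n m
  proof -
    have "norm (delta_term c t (\<lambda>s. s ^ m) n) = norm (qpoch c q n) * norm (1 / qpoch q q n) *
        norm t ^ n * norm (q_Delta q c (\<lambda>s. s ^ m) n)"
      by (simp add: delta_term_def norm_mult norm_divide norm_power)
    also have "\<dots> \<le> qpoch_bound (norm c) * inv_bound * norm t ^ n * (K * (r ^ m / r ^ n))"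
      using inv_bound_pos by (intro mult_mono K norm_qpoch_le norm_inverse_qpoch_q_le mult_nonneg_nonneg)
        (auto intro: less_imp_le)
    finally have "norm (x n m) \<le> norm (a m) *
        (qpoch_bound (norm c) * inv_bound * norm t ^ n * (K * (r ^ m / r ^ n)))"
      unfolding x_def norm_mult by (intro mult_left_mono) auto
    then show ?thesis by (simp add: power_divide mult_ac)
  qed
  have "summable (\<lambda>n. (norm t / r) ^ n)"
    using r by (intro summable_geometric) auto
  then have sum_t: "summable (\<lambda>n. qpoch_bound (norm c) * inv_bound * K * (norm t / r) ^ n)"
    by (rule summable_mult)
  note X = dominated_double_series[of x, OF x_le sum_t sum_a]
  have x_rows: "(\<Sum>m. x n m) = delta_term c t f n" for n
  proof -
    define w where "w k = qpoch c q n / qpoch q q n * t ^ n * 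
      (qpochs [inverse q ^ n, c * q ^ n] q k / qpoch q q k) * q ^ k" for k
    have "(\<lambda>m. \<Sum>k\<le>n. w k * (a m * (q ^ k) ^ m)) sums (\<Sum>k\<le>n. w k * f (q ^ k))"
    proof (intro sums_sum sums_mult f_sums)
      fix k show "norm (q ^ k) < R" 
        using norm_q_power_le_1[of k] R by (simp add: norm_power)
    qed
    moreover have "(\<Sum>k\<le>n. w k * (a m * (q ^ k) ^ m)) = x n m" for m
      unfolding x_def delta_term_def q_Delta_def w_def sum_distrib_left by (simp add: mult_ac)
    moreover have "(\<Sum>k\<le>n. w k * f (q ^ k)) = delta_term c t f n"
      unfolding delta_term_def q_Delta_def w_def sum_distrib_left by (simp add: mult_ac)
    ultimately show ?thesis by (simp add: sums_iff)
  qed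
  have x_cols: "(\<Sum>n. x n m) = qpoch_inf c q / theta t * (a m * jackson c t (\<lambda>s. s ^ m))" for m
    using sums_mult[OF power_id[unfolded transform_identity_def], of "a m"]
    by (simp add: x_def sums_iff)

  define y where "y n m = a m * q_integral_term q t 1 (\<lambda>s. weight c t s * s ^ m) n" for n m
  obtain K1 where K1: "\<And>n. norm (weight c t (1 * q ^ n)) \<le> K1" "K1 > 0"
    using weight_bounded[of c 1 t] adm by (auto simp: admissible_def)
  obtain K2 where K2: "\<And>n. norm (weight c t (t * q ^ n)) \<le> K2" "K2 > 0"
    using weight_bounded[of c t t] adm by (auto simp: admissible_def)
  have y_le: "norm (y n m) \<le> (norm q ^ n * (K1 + norm t * K2)) * (norm (a m) * r ^ m)" for n m
  proof -
    have p: "norm ((u * q ^ n) ^ m) \<le> r ^ m" if "norm u \<le> r" for u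
      unfolding norm_power using that norm_mult_q_power_le[of u n]
      by (intro power_mono) (auto intro: order_trans)
    have "norm (u * q ^ n * (weight c t (u * q ^ n) * (u * q ^ n) ^ m)) \<le>
        norm u * norm q ^ n * (B * r ^ m)"
      if "norm u \<le> r" "norm (weight c t (u * q ^ n)) \<le> B" "B > 0" for u B
      unfolding norm_mult[of "u * q ^ n"] norm_mult[of u] norm_mult[of "weight c t (u * q ^ n)"]
        norm_power[of q]
      using that p[OF that(1)] by (intro mult_mono) auto
    from this[of 1 K1] this[of t K2]
    have "norm (q_integral_term q t 1 (\<lambda>s. weight c t s * s ^ m) n) \<le>
        norm (1 :: complex) * norm q ^ n * (K1 * r ^ m) + norm t * norm q ^ n * (K2 * r ^ m)"
      unfolding q_integral_term_def using K1 K2 r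
      by (intro order_trans[OF norm_triangle_ineq4] add_mono) auto
    then have "norm (y n m) \<le> norm (a m) *
        (norm (1 :: complex) * norm q ^ n * (K1 * r ^ m) + norm t * norm q ^ n * (K2 * r ^ m))"
      unfolding y_def norm_mult[of "a m"] by (intro mult_left_mono) auto
    then show ?thesis by (simp add: algebra_simps)
  qed
  note Y = dominated_double_series[of y, OF y_le summable_mult2[OF summable_q_power] sum_a]
  have y_rows: "(\<Sum>m. y n m) = q_integral_term q t 1 (\<lambda>s. weight c t s * f s) n" for n
  proof -
    have "norm (1 * q ^ n) < R" "norm (t * q ^ n) < R"
      using norm_mult_q_power_le[of 1 n] norm_mult_q_power_le[of t n] R by auto
    from sums_diff[OF sums_mult[OF f_sums[OF this(1)], of "1 * q ^ n * weight c t (1 * q ^ n)"]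
        sums_mult[OF f_sums[OF this(2)], of "t * q ^ n * weight c t (t * q ^ n)"]]
    have "(\<lambda>m. y n m) sums q_integral_term q t 1 (\<lambda>s. weight c t s * f s) n"
      by (simp add: y_def q_integral_term_def right_diff_distrib mult_ac)
    then show ?thesis by (simp add: sums_iff)
  qed
  have y_cols: "(\<Sum>n. y n m) = a m * jackson c t (\<lambda>s. s ^ m)" for m
    unfolding y_def jackson_def q_integral_def
    using jackson_split(3)[OF adm power_bd] by (intro suminf_mult) (simp add: q_integrable_def)
  have J: "(\<lambda>m. a m * jackson c t (\<lambda>s. s ^ m)) sums jackson c t f"
  proof -
    have "jackson c t f = (\<Sum>m. a m * jackson c t (\<lambda>s. s ^ m))"
      using Y(4) unfolding y_rows y_cols jackson_def q_integral_def by (simp add: sums_iff)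
    then show ?thesis
      using Y(3) unfolding y_cols by (simp add: sums_iff)
  qed
  have "(\<Sum>m. \<Sum>n. x n m) = qpoch_inf c q / theta t * jackson c t f"
    unfolding x_cols using sums_mult[OF J] by (simp only: sums_iff)
  then show ?thesis
    using X(4) unfolding x_rows transform_identity_def by simp
qed

end

theorem theorem3p3:
  fixes q c t :: complex and R :: real and f :: "complex \<Rightarrow> complex"
  assumes "0 < norm q" and "norm q < 1"
    and "R > 1"
    and "f holomorphic_on ball 0 R"
    and "norm t < R"
    and "t \<noteq> 0"
    and "qpochs_inf [q, t, q / t] q \<noteq> 0"
    and "\<And>n. qpoch_inf (c * (q ^ n)\<^sup>2) q \<noteq> 0"
    and "\<And>n. qpoch_inf (c * (t * q ^ n)\<^sup>2) q \<noteq> 0"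
  shows "let g = (\<lambda>s. qpochs_inf [s * q / t, s * q, c * t * s] q / qpoch_inf (c * s\<^sup>2) q * f s)
         in summable (\<lambda>n. qpoch c q n / qpoch q q n * t ^ n * q_Delta q c f n) \<and>
            q_integrable q t 1 g \<and>
            (\<Sum>n. qpoch c q n / qpoch q q n * t ^ n * q_Delta q c f n) =
              qpoch_inf c q / qpochs_inf [q, t, q / t] q * q_integral q t 1 g"
proof -
  interpret nome q by unfold_locales (fact assms)+
  have theta: "qpochs_inf [q, t, q / t] q = theta t"
    by (simp add: qpochs_inf_def theta_def)
  have weight: "qpochs_inf [s * q / t, s * q, c * t * s] q / qpoch_inf (c * s\<^sup>2) q = weight c t s" for s
    by (simp add: qpochs_inf_def weight_def)
  have adm: "admissible c t"
    using assms(6,7) assms(8)[of 0] assms(9)[of 0] by (simp add: admissible_def theta)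
  have "continuous_on (cball 0 (max 1 (norm t))) f"
    using assms(3-5) by (intro holomorphic_on_imp_continuous_on holomorphic_on_subset[OF assms(4)]) auto
  then have "q_integrable q t 1 (\<lambda>s. weight c t s * f s)"
    by (intro jackson_split(3)[OF adm] bounded_on_grid_continuous)
  moreover have "delta_term c t f sums (qpoch_inf c q / theta t * jackson c t f)"
    using transform_identity_holomorphic[OF adm assms(3,5,4)] by (simp add: transform_identity_def)
  ultimately show ?thesis
    unfolding Let_def theta weight
    by (simp add: sums_iff jackson_def delta_term_def[abs_def])
qed

end
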